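(* Let $\mathbf{E}\subset\mathbb{C}^{\mathbb{Z}^+}$ be a Banach space of sequences satisfying (i)–(iii) of the context, and suppose that $\mathbf{S}$ and $\mathbf{S}_{-1}$ are bounded. Let $T$ be a bounded operator on $\mathbf{E}$ commuting with $\mathbf{S}$. Then $$\overline{\widetilde{T}(\overset{\circ}{\sigma(\mathbf{S})})}\subset\sigma(T).$$ If $T$ is a bounded operator on $\mathbf{E}$ commuting with $\mathbf{S}_{-1}$, then $$\overline{\widetilde{T}(\overset{\circ}{\sigma(\mathbf{S}_{-1})})}\subset\sigma(T).$$
   Context: $\mathbb{Z}^+$ is the set of non-negative integers and $F(\mathbb{Z}^+)$ the set of complex sequences on $\mathbb{Z}^+$ with finitely many non-zero terms. $\mathbf{E}\subset\mathbb{C}^{\mathbb{Z}^+}$ is a Banach space with: (i) $F(\mathbb{Z}^+)$ is a dense subset of $\mathbf{E}$; (ii) for every $n\in\mathbb{Z}^+$ the map $x\mapsto x(n)$ is continuous from $\mathbf{E}$ into $\mathbb{C}$; (iii) for every $z\in\mathbb{T}=\{z\in\mathbb{C}:|z|=1\}$ and $x\in\mathbf{E}$, $\gamma_z(x)=(z^nx(n))_{n\in\mathbb{Z}^+}\in\mathbf{E}$, and $\sup_{z\in\mathbb{T}}\|\gamma_z\|<+\infty$. On $\mathbb{C}^{\mathbb{Z}^+}$ define $(\mathbf{S}u)(0)=0$, $(\mathbf{S}u)(n)=u(n-1)$ for $n\ge1$, and $(\mathbf{S}_{-1}u)(n)=u(n+1)$ for $n\ge0$. $\mathbf{S}$ (resp.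 $\mathbf{S}_{-1}$) is called bounded if it maps $\mathbf{E}$ into $\mathbf{E}$; its restriction to $\mathbf{E}$ is then a bounded operator, and $\sigma(\mathbf{S})$ (resp. $\sigma(\mathbf{S}_{-1})$) denotes the spectrum of this restriction. $\sigma(T)$ is the spectrum of $T$ on $\mathbf{E}$. For $n\ge0$ let $e_n$ be the sequence equal to $1$ at $n$ and $0$ elsewhere. For a bounded operator $T$ on $\mathbf{E}$ commuting with $\mathbf{S}$ or with $\mathbf{S}_{-1}$, set $\widehat{T}(n)=(Te_0)(n)$ and $\widehat{T}(-n)=(Te_n)(0)$ for $n\ge0$; the symbol of $T$ is $\widetilde{T}(z)=\sum_{n\in\mathbb{Z}}\widehat{T}(n)z^n$, for $z\in\mathbb{C}$ (a series that a priori could diverge). For a set $A\subset\mathbb{C}$, $\overset{\circ}{A}$ denotes its interior and $\overline{A}$ its closure.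
   Formalization: In the second inclusion the symbol is taken at 1/w for w in the interior of σ(S_{-1}) (at w=0 its value is T̂(0)); as written it fails, e.g. E=ℓ², T=S_{-1}, where T̃(z)=1/z and T̃(1/2)=2 is not in σ(T). *)

theory Defs
  imports "HOL-Analysis.Analysis" "HOL-Library.Function_Algebras"
begin

definition finite_support :: "(nat \<Rightarrow> complex) set" where
  "finite_support = {x. finite {n. x n \<noteq> 0}}"

definition rotation :: "complex \<Rightarrow> (nat \<Rightarrow> complex) \<Rightarrow> nat \<Rightarrow> complex" where
  "rotation z x = (\<lambda>n. z ^ n * x n)"

text \<open>
  The library predicate \<open>Metric_space\<close> requires nonnegativity and symmetry of the distance
  also outside the carrier, hence the guard.
\<close>

definition seq_dist ::
  "(nat \<Rightarrow> complex) set \<Rightarrow> ((nat \<Rightarrow> complex) \<Rightarrow> real)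
    \<Rightarrow> (nat \<Rightarrow> complex) \<Rightarrow> (nat \<Rightarrow> complex) \<Rightarrow> real" where
  "seq_dist E nrm x y = (if x \<in> E \<and> y \<in> E then nrm (x - y) else 0)"

text \<open>
  A complex Banach space of sequences is given by a carrier \<open>E\<close> and a norm \<open>nrm\<close>
  whose values outside \<open>E\<close> are irrelevant. The distribution has no class of complex
  normed spaces, hence the explicit axioms; the topology and completeness are those
  of the library metric space on \<open>E\<close>. The last assumption says that the operator norms of
  the rotations by unimodular numbers have a common bound.
\<close>

locale banach_sequence_space =
  fixes E :: "(nat \<Rightarrow> complex) set" and nrm :: "(nat \<Rightarrow> complex) \<Rightarrow> real"
  assumes zero_mem: "0 \<in> E"
    and add_mem: "\<lbrakk>x \<in> E; y \<in> E\<rbrakk> \<Longrightarrow> x + y \<in> E"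
    and scale_mem: "x \<in> E \<Longrightarrow> (\<lambda>n. c * x n) \<in> E"
    and nrm_nonneg: "x \<in> E \<Longrightarrow> 0 \<le> nrm x"
    and nrm_eq_0_iff: "x \<in> E \<Longrightarrow> nrm x = 0 \<longleftrightarrow> x = 0"
    and nrm_triangle: "\<lbrakk>x \<in> E; y \<in> E\<rbrakk> \<Longrightarrow> nrm (x + y) \<le> nrm x + nrm y"
    and nrm_scale: "x \<in> E \<Longrightarrow> nrm (\<lambda>n. c * x n) = cmod c * nrm x"
    and complete: "Metric_space.mcomplete E (seq_dist E nrm)"
    and finite_support_subset: "finite_support \<subseteq> E"
    and finite_support_dense:
      "Metric_space.mtopology E (seq_dist E nrm) closure_of finite_support = E"
    and continuous_coordinate:
      "continuous_map (Metric_space.mtopology E (seq_dist E nrm)) euclidean (\<lambda>x. x n)"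
    and rotation_mem: "\<lbrakk>cmod z = 1; x \<in> E\<rbrakk> \<Longrightarrow> rotation z x \<in> E"
    and rotation_bounded:
      "\<exists>C. \<forall>z x. cmod z = 1 \<longrightarrow> x \<in> E \<longrightarrow> nrm (rotation z x) \<le> C * nrm x"

context banach_sequence_space
begin

lemma diff_mem: "x - y \<in> E" if "x \<in> E" "y \<in> E"
proof -
  have "x - y = x + (\<lambda>n. (-1) * y n)"
    by (auto simp: fun_eq_iff)
  then show ?thesis
    using that add_mem scale_mem by metis
qed

lemma Metric_space_seq_dist: "Metric_space E (seq_dist E nrm)"
proof
  show "0 \<le> seq_dist E nrm x y" for x y
    by (simp add: seq_dist_def nrm_nonneg diff_mem)
  show "seq_dist E nrm x y = seq_dist E nrm y x" for x y
  proof (cases "x \<in> E \<and> y \<in> E")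
    case True
    have "y - x = (\<lambda>n. (-1) * (x - y) n)"
      by (auto simp: fun_eq_iff)
    then have "nrm (y - x) = nrm (x - y)"
      using nrm_scale[of "x - y" "-1"] diff_mem True by simp
    with True show ?thesis
      by (simp add: seq_dist_def)
  qed (auto simp: seq_dist_def)
  show "seq_dist E nrm x y = 0 \<longleftrightarrow> x = y" if "x \<in> E" "y \<in> E" for x y
    using that nrm_eq_0_iff[of "x - y"] by (simp add: seq_dist_def diff_mem)
  show "seq_dist E nrm x z \<le> seq_dist E nrm x y + seq_dist E nrm y z"
    if "x \<in> E" "y \<in> E" "z \<in> E" for x y z
    using that nrm_triangle[of "x - y" "y - z"] by (simp add: seq_dist_def diff_mem)
qed

end

definition right_shift :: "(nat \<Rightarrow> complex) \<Rightarrow> nat \<Rightarrow> complex" where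
  "right_shift u = (\<lambda>n. if n = 0 then 0 else u (n - 1))"

definition left_shift :: "(nat \<Rightarrow> complex) \<Rightarrow> nat \<Rightarrow> complex" where
  "left_shift u = (\<lambda>n. u (n + 1))"

text \<open>
  Operators on \<open>E\<close> are functions on all sequences of which only the restriction to \<open>E\<close>
  matters.
\<close>

definition bounded_operator ::
  "(nat \<Rightarrow> complex) set \<Rightarrow> ((nat \<Rightarrow> complex) \<Rightarrow> real)
    \<Rightarrow> ((nat \<Rightarrow> complex) \<Rightarrow> (nat \<Rightarrow> complex)) \<Rightarrow> bool" where
  "bounded_operator E nrm T \<longleftrightarrow>
     (\<forall>x\<in>E. T x \<in> E) \<and>
     (\<forall>x\<in>E. \<forall>y\<in>E. T (x + y) = T x + T y) \<and>
     (\<forall>c. \<forall>x\<in>E. T (\<lambda>n. c * x n) = (\<lambda>n. c * T x n)) \<and>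
     (\<exists>K. \<forall>x\<in>E. nrm (T x) \<le> K * nrm x)"

definition commute_on ::
  "(nat \<Rightarrow> complex) set \<Rightarrow> ((nat \<Rightarrow> complex) \<Rightarrow> (nat \<Rightarrow> complex))
    \<Rightarrow> ((nat \<Rightarrow> complex) \<Rightarrow> (nat \<Rightarrow> complex)) \<Rightarrow> bool" where
  "commute_on E T U \<longleftrightarrow> (\<forall>x\<in>E. T (U x) = U (T x))"

definition spectrum_on ::
  "(nat \<Rightarrow> complex) set \<Rightarrow> ((nat \<Rightarrow> complex) \<Rightarrow> real)
    \<Rightarrow> ((nat \<Rightarrow> complex) \<Rightarrow> (nat \<Rightarrow> complex)) \<Rightarrow> complex set" where
  "spectrum_on E nrm T =
     {c. \<not> (\<exists>R. bounded_operator E nrm R \<and>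
               (\<forall>x\<in>E. R (\<lambda>n. T x n - c * x n) = x) \<and>
               (\<forall>x\<in>E. (\<lambda>n. T (R x) n - c * R x n) = x))}"

definition unit_seq :: "nat \<Rightarrow> nat \<Rightarrow> complex" where
  "unit_seq k = (\<lambda>n. if n = k then 1 else 0)"

definition symbol_coeff :: "((nat \<Rightarrow> complex) \<Rightarrow> (nat \<Rightarrow> complex)) \<Rightarrow> int \<Rightarrow> complex" where
  "symbol_coeff T n =
     (if 0 \<le> n then T (unit_seq 0) (nat n) else T (unit_seq (nat (- n))) 0)"

definition symbol_summable ::
  "((nat \<Rightarrow> complex) \<Rightarrow> (nat \<Rightarrow> complex)) \<Rightarrow> complex \<Rightarrow> bool" where
  "symbol_summable T z \<longleftrightarrow> (\<lambda>n. symbol_coeff T n * z powi n) summable_on UNIV"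

text \<open>
  The value is meaningful where \<open>symbol_summable T z\<close> holds.

  An operator commuting with the left shift has vanishing coefficients of positive index, so
  its symbol is a power series in \<open>inverse z\<close>; the left shift itself has symbol
  \<open>inverse z\<close>. Hence a point \<open>w\<close> of the spectrum of the left shift corresponds to the
  argument \<open>z = inverse w\<close> of the symbol. For \<open>w = 0\<close>, that is \<open>z\<close> at infinity, the
  library conventions \<open>inverse 0 = 0\<close> and \<open>0 powi n = 0\<close> for \<open>n < 0\<close> yield the
  coefficient of index \<open>0\<close>, which is the value of that power series there.
\<close>

definition symbol :: "((nat \<Rightarrow> complex) \<Rightarrow> (nat \<Rightarrow> complex)) \<Rightarrow> complex \<Rightarrow> complex" where
  "symbol T z = (\<Sum>\<^sub>\<infinity>n\<in>UNIV. symbol_coeff T n * z powi n)"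

end

theory Submission
  imports Defs
begin

text \<open>
  Let \<open>U\<close> be one of the two shifts and let \<open>T\<close> commute with \<open>U\<close>. Comparing coordinates of
  \<open>T e\<^sub>j\<close> for different \<open>j\<close> shows that, on finitely supported sequences, \<open>T\<close> acts as the formal
  series \<open>\<Sum>n. \<tau>\<^sub>n U\<^sup>n\<close>, where \<open>\<tau>\<^sub>n = (T e\<^sub>0)(n)\<close> for the right shift and
  \<open>\<tau>\<^sub>n = (T e\<^sub>n)(0)\<close> for the left shift. The symbol at \<open>z\<close>, or at \<open>inverse z\<close> for the left
  shift, is the power series \<open>\<Sum>n. \<tau>\<^sub>n z\<^sup>n\<close>.

  Convergence. Averaging the conjugates of \<open>T\<close> by rotations against a character isolates the single
  term \<open>\<tau>\<^sub>n U\<^sup>n\<close>, and the rotations are uniformly bounded, so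
  \<open>\<bar>\<tau>\<^sub>n\<bar> \<parallel>U\<^sup>n x\<parallel> \<le> M \<parallel>x\<parallel>\<close> with \<open>M\<close> independent of \<open>n\<close>
  (\<open>homogeneous_component_bound\<close>). If \<open>w \<noteq> 0\<close> is in the spectrum of \<open>U\<close>, then no power of
  \<open>U / w\<close> is a strict contraction, hence \<open>\<bar>\<tau>\<^sub>n\<bar> \<bar>w\<bar>\<^sup>n \<le> M\<close> (\<open>spectrum_growth\<close>).
  An interior point \<open>z\<close> of the spectrum is dominated in modulus by such a \<open>w\<close>, so the power
  series converges absolutely at \<open>z\<close>.

  Inclusion. Suppose that the value \<open>c\<close> of the series at \<open>z\<close> were not in the spectrum of \<open>T\<close>. The
  inverse of \<open>T - c\<close> also commutes with \<open>U\<close>, so its series converges absolutely at \<open>z\<close> too. The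
  formal series of \<open>T - c\<close> and of its inverse have Cauchy product \<open>1\<close>, and evaluating at \<open>z\<close> gives
  \<open>0 = 1\<close> (\<open>cauchy_inverse_series\<close>, \<open>spectral_inclusion_of_symbol\<close>). The closure
  comes for free, since a spectrum is closed.

  Two tools are developed for spaces given by a carrier and a norm: the closed graph theorem, which
  makes the shifts bounded as soon as they preserve the space, and the invertibility of
  perturbations of the identity by strict contractions.
\<close>

section \<open>Power series and their reciprocals\<close>

text \<open>
  If \<open>A(z) - c\<close> has the formal reciprocal \<open>B(z)\<close>, and both series converge absolutely at \<open>z\<close>, then
  \<open>(A(z) - c) B(z) = 1\<close> holds for the values as well, so the first factor is not zero.
\<close>

lemma cauchy_inverse_series:
  fixes a b :: "nat \<Rightarrow> complex"
  assumes a: "summable (\<lambda>n. norm (a n * z ^ n))" and b: "summable (\<lambda>n. norm (b n * z ^ n))"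
    and inverse: "\<And>n. (\<Sum>k\<le>n. a k * b (n - k)) - c * b n = (if n = 0 then 1 else 0)"
  shows "(\<Sum>n. a n * z ^ n) \<noteq> c"
proof
  assume c: "(\<Sum>n. a n * z ^ n) = c"
  let ?B = "\<Sum>n. b n * z ^ n"
  have "(\<lambda>n. \<Sum>k\<le>n. (a k * z ^ k) * (b (n - k) * z ^ (n - k))) sums (c * ?B)"
    using Cauchy_product_sums[OF a b] c by simp
  also have "(\<lambda>n. \<Sum>k\<le>n. (a k * z ^ k) * (b (n - k) * z ^ (n - k)))
      = (\<lambda>n. (if n = 0 then 1 else 0) + c * (b n * z ^ n))"
  proof
    fix n
    have "(\<Sum>k\<le>n. (a k * z ^ k) * (b (n - k) * z ^ (n - k))) = (\<Sum>k\<le>n. a k * b (n - k)) * z ^ n"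
      unfolding sum_distrib_right
    proof (rule sum.cong[OF refl])
      fix k assume "k \<in> {..n}"
      then have "z ^ n = z ^ k * z ^ (n - k)"
        by (simp flip: power_add)
      then show "(a k * z ^ k) * (b (n - k) * z ^ (n - k)) = a k * b (n - k) * z ^ n"
        by (simp add: mult_ac)
    qed
    also have "(\<Sum>k\<le>n. a k * b (n - k)) = (if n = 0 then 1 else 0) + c * b n"
      using inverse[of n] by (simp add: algebra_simps)
    finally show "(\<Sum>k\<le>n. (a k * z ^ k) * (b (n - k) * z ^ (n - k)))
        = (if n = 0 then 1 else 0) + c * (b n * z ^ n)"
      by (simp add: algebra_simps)
  qed
  finally have "(\<lambda>n. (if n = 0 then 1 else 0) + c * (b n * z ^ n)) sums (c * ?B)" .
  moreover have "(\<lambda>n. (if n = 0 then 1 else 0) + c * (b n * z ^ n)) sums (1 + c * ?B)"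
    by (intro sums_add sums_mult summable_sums summable_norm_cancel[OF b])
      (use sums_single[of 0 "\<lambda>_. 1 :: complex"] in simp)
  ultimately have "c * ?B = 1 + c * ?B"
    by (rule sums_unique2)
  then show False
    by simp
qed

text \<open>
  Moving \<open>z\<close> slightly away from the origin stays inside the set.
\<close>

lemma interior_point_larger_norm:
  fixes z :: complex
  assumes "z \<in> interior S"
  shows "\<exists>w\<in>S. cmod z < cmod w"
proof -
  obtain e where e: "e > 0" "ball z e \<subseteq> S"
    using assms by (auto simp: mem_interior)
  \<comment> \<open>The outward direction at \<open>z\<close>; at the origin any unit vector serves.\<close>
  define u where "u = (if z = 0 then 1 else sgn z)"
  define w where "w = z + of_real (e / 2) * u"
  have u: "cmod u = 1"
    by (simp add: u_def norm_sgn)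
  have "dist z w = e / 2"
    using e(1) u by (simp add: w_def dist_norm norm_mult)
  then have "w \<in> S"
    using e by auto
  moreover have "w = of_real (cmod z + e / 2) * u"
  proof -
    have "z = of_real (cmod z) * u"
      by (simp add: u_def sgn_eq)
    then have "w = of_real (cmod z) * u + of_real (e / 2) * u"
      by (simp only: w_def)
    then show ?thesis
      by (simp only: of_real_add distrib_right)
  qed
  then have "cmod w = cmod z + e / 2"
    using e(1) u by (simp add: norm_mult flip: of_real_add)
  ultimately show ?thesis
    using e(1) by (intro bexI[of _ w]) auto
qed

section \<open>Unit sequences and powers of the shifts\<close>

lemma sum_seq_apply: "(\<Sum>i\<in>I. f i) n = (\<Sum>i\<in>I. f i n)" for f :: "'i \<Rightarrow> nat \<Rightarrow> complex"
  by (induction I rule: infinite_finite_induct) auto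

lemma unit_seq_same: "unit_seq k k = 1"
  by (simp add: unit_seq_def)

lemma unit_seq_other: "n \<noteq> k \<Longrightarrow> unit_seq k n = 0"
  by (simp add: unit_seq_def)

lemma finite_support_expansion:
  assumes "finite {n. x n \<noteq> 0}"
  shows "x = (\<Sum>j | x j \<noteq> 0. (\<lambda>n. x j * unit_seq j n))"
proof
  fix n
  show "x n = (\<Sum>j | x j \<noteq> 0. (\<lambda>n. x j * unit_seq j n)) n"
    using assms by (auto simp: sum_seq_apply unit_seq_def if_distrib sum.delta' cong: if_cong)
qed

lemma unit_seq_funpow_right_shift: "(right_shift ^^ j) (unit_seq 0) = unit_seq j"
  by (induction j) (auto simp: right_shift_def unit_seq_def fun_eq_iff)

lemma funpow_right_shift: "(right_shift ^^ j) u m = (if j \<le> m then u (m - j) else 0)"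
  by (induction j arbitrary: m) (auto simp: right_shift_def)

lemma funpow_left_shift: "(left_shift ^^ j) u m = u (m + j)"
  by (induction j arbitrary: m) (auto simp: left_shift_def)

section \<open>Roots of unity and arithmetic progressions of coordinates\<close>

text \<open>
  The projection onto the coordinates \<open>m \<equiv> k (mod N)\<close>. It is the average of the rotations by the
  \<open>N\<close>-th roots of unity against the character \<open>z \<mapsto> z\<^sup>-\<^sup>k\<close>. The index \<open>k\<close> is an integer because the
  left shift lowers degrees.
\<close>

definition progression_part :: "nat \<Rightarrow> int \<Rightarrow> (nat \<Rightarrow> complex) \<Rightarrow> nat \<Rightarrow> complex" where
  "progression_part N k u = (\<lambda>m. if int N dvd int m - k then u m else 0)"

text \<open>
  The limit of the preceding projections as \<open>N\<close> grows; it vanishes for negative \<open>k\<close>.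
\<close>

definition coordinate_part :: "int \<Rightarrow> (nat \<Rightarrow> complex) \<Rightarrow> nat \<Rightarrow> complex" where
  "coordinate_part k u = (\<lambda>m. if int m = k then u m else 0)"

lemma coordinate_part_eq_unit_seq:
  "coordinate_part k u = (\<lambda>m. (if 0 \<le> k then u (nat k) else 0) * unit_seq (nat k) m)"
  by (auto simp: coordinate_part_def unit_seq_def fun_eq_iff)

definition unity_root :: "nat \<Rightarrow> nat \<Rightarrow> complex" where
  "unity_root N i = cis (2 * pi * real i / real N)"

lemma norm_unity_root [simp]: "cmod (unity_root N i) = 1"
  by (simp add: unity_root_def)

lemma unity_root_nonzero [simp]: "unity_root N i \<noteq> 0"
  by (simp add: unity_root_def)

lemma sum_unity_root_powi:
  assumes N: "N > 0"
  shows "(\<Sum>i<N. unity_root N i powi d) = (if int N dvd d then of_nat N else 0)"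
proof -
  define z where "z = cis (2 * pi * of_int d / real N)"
  have pow: "unity_root N i powi d = z ^ i" for i
  proof -
    have "unity_root N i powi d = cis (of_int d * (2 * pi * real i / real N))"
      by (simp only: unity_root_def cis_power_int)
    also have "of_int d * (2 * pi * real i / real N) = real i * (2 * pi * of_int d / real N)"
      by simp
    also have "cis \<dots> = z ^ i"
      unfolding z_def by (rule Complex.DeMoivre[symmetric])
    finally show ?thesis .
  qed
  have zN: "z ^ N = 1"
  proof -
    have "z ^ N = cis (real N * (2 * pi * of_int d / real N))"
      unfolding z_def by (rule Complex.DeMoivre)
    also have "real N * (2 * pi * of_int d / real N) = 2 * pi * of_int d"
      using N by simp
    also have "cis \<dots> = 1"
      by (rule cis_multiple_2pi) simp
    finally show ?thesis .
  qed
  show ?thesis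
  proof (cases "int N dvd d")
    case True
    then obtain k where "d = int N * k"
      by blast
    then have "2 * pi * of_int d / real N = 2 * pi * of_int k"
      using N by simp
    then have "z = cis (2 * pi * of_int k)"
      by (simp only: z_def)
    also have "\<dots> = 1"
      by (rule cis_multiple_2pi) simp
    finally have "z = 1" .
    then show ?thesis
      using True by (simp add: pow)
  next
    case False
    have "z \<noteq> 1"
    proof
      assume "z = 1"
      then have "cos (2 * pi * of_int d / real N) = 1"
        by (simp add: z_def complex_eq_iff)
      then obtain k :: int where "2 * pi * of_int d / real N = of_int k * 2 * pi"
        using cos_one_2pi_int by blast
      then have "real_of_int d = of_int (k * int N)"
        using N by (simp add: field_simps)
      then have "d = k * int N"
        by (simp only: of_int_eq_iff)
      then show False
        using False by simp
    qed
    then show ?thesis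
      using False zN by (simp add: pow sum_gp_strict)
  qed
qed

lemma progression_part_average:
  assumes N: "N > 0"
  shows "progression_part N k u =
    (\<lambda>m. (1 / of_nat N) * (\<Sum>i<N. (\<lambda>m. unity_root N i powi (- k) * rotation (unity_root N i) u m)) m)"
proof
  fix m
  have "(\<Sum>i<N. (\<lambda>m. unity_root N i powi (- k) * rotation (unity_root N i) u m)) m
    = (\<Sum>i<N. unity_root N i powi (int m - k)) * u m"
    unfolding sum_seq_apply sum_distrib_right
  proof (rule sum.cong[OF refl])
    fix i
    show "unity_root N i powi (- k) * rotation (unity_root N i) u m = unity_root N i powi (int m - k) * u m"
      using power_int_add[of "unity_root N i" "- k" "int m"]
      by (simp add: rotation_def mult.assoc)
  qed
  then show "progression_part N k u m =
    (1 / of_nat N) * (\<Sum>i<N. (\<lambda>m. unity_root N i powi (- k) * rotation (unity_root N i) u m)) m"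
    using N by (simp add: sum_unity_root_powi progression_part_def)
qed

section \<open>Norm, convergence and completeness\<close>

context banach_sequence_space
begin

lemma minus_mem: "- x \<in> E" if "x \<in> E"
  using diff_mem[OF zero_mem that] by simp

lemma sum_mem: "(\<And>i. i \<in> I \<Longrightarrow> f i \<in> E) \<Longrightarrow> (\<Sum>i\<in>I. f i) \<in> E"
  by (induction I rule: infinite_finite_induct) (auto simp: zero_mem add_mem)

lemma nrm_zero: "nrm 0 = 0"
  using nrm_eq_0_iff[OF zero_mem] by simp

lemma nrm_minus: "nrm (- x) = nrm x" if "x \<in> E"
proof -
  have "- x = (\<lambda>n. (-1) * x n)"
    by (auto simp: fun_eq_iff)
  then show ?thesis
    using nrm_scale[OF that, of "-1"] by simp
qed

lemma nrm_minus_commute: "nrm (x - y) = nrm (y - x)" if "x \<in> E" "y \<in> E"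
  using nrm_minus[of "x - y"] that by (simp add: diff_mem)

lemma nrm_triangle_diff: "nrm (x - y) \<le> nrm x + nrm y" if "x \<in> E" "y \<in> E"
  using nrm_triangle[of x "- y"] that by (simp add: minus_mem nrm_minus)

lemma nrm_le_diff_add: "nrm x \<le> nrm (x - y) + nrm y" if "x \<in> E" "y \<in> E"
  using nrm_triangle[of "x - y" y] that by (simp add: diff_mem)

lemma nrm_sum: "(\<And>i. i \<in> I \<Longrightarrow> f i \<in> E) \<Longrightarrow> nrm (\<Sum>i\<in>I. f i) \<le> (\<Sum>i\<in>I. nrm (f i))"
proof (induction I rule: infinite_finite_induct)
  case (insert i I)
  have "nrm (f i + sum f I) \<le> nrm (f i) + nrm (sum f I)"
    using insert.prems by (intro nrm_triangle sum_mem) auto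
  also have "\<dots> \<le> nrm (f i) + (\<Sum>i\<in>I. nrm (f i))"
    using insert by simp
  finally show ?case
    unfolding sum.insert[OF insert.hyps(1,2)] .
qed (auto simp: nrm_zero)

lemma finite_support_approx:
  assumes "x \<in> E" "e > 0"
  obtains p where "p \<in> finite_support" "p \<in> E" "nrm (x - p) < e"
proof -
  interpret M: Metric_space E "seq_dist E nrm"
    by (rule Metric_space_seq_dist)
  have "x \<in> M.mtopology closure_of finite_support"
    using assms finite_support_dense by simp
  then obtain p where "p \<in> finite_support" "p \<in> M.mball x e"
    using \<open>e > 0\<close> by (auto simp: M.metric_closure_of)
  then show ?thesis
    using that by (auto simp: M.in_mball seq_dist_def)
qed

text \<open>
  A continuous linear functional is bounded: some ball around \<open>0\<close> is mapped into the unit disc, and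
  every vector can be scaled into that ball.
\<close>

lemma coordinate_bounded: "\<exists>M\<ge>0. \<forall>x\<in>E. cmod (x n) \<le> M * nrm x"
proof -
  interpret M: Metric_space E "seq_dist E nrm"
    by (rule Metric_space_seq_dist)
  have "openin M.mtopology {x \<in> E. x n \<in> ball 0 1}"
    using openin_continuous_map_preimage[OF continuous_coordinate, of "ball 0 1" n] by simp
  then obtain r where r: "r > 0" "M.mball 0 r \<subseteq> {x \<in> E. x n \<in> ball 0 1}"
    unfolding M.openin_mtopology using zero_mem by force
  have small: "cmod (x n) < 1" if "x \<in> E" "nrm x < r" for x
  proof -
    have "x \<in> M.mball 0 r"
      using that nrm_minus[of x] by (simp add: M.in_mball zero_mem seq_dist_def)
    then show ?thesis
      using r by auto
  qed
  have "cmod (x n) \<le> (2 / r) * nrm x" if x: "x \<in> E" for x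
  proof (cases "x = 0")
    case False
    then have pos: "nrm x > 0"
      using nrm_nonneg[OF x] nrm_eq_0_iff[OF x] by linarith
    define t where "t = r / (2 * nrm x)"
    have t: "t > 0"
      using r pos by (simp add: t_def)
    have "t * nrm x < r"
      using r pos by (simp add: t_def)
    then have "nrm (\<lambda>m. of_real t * x m) < r"
      using nrm_scale[OF x, of "of_real t"] t by simp
    from small[OF scale_mem[OF x] this] have "t * cmod (x n) < 1"
      using t by (simp add: norm_mult)
    then show ?thesis
      using t pos r by (simp add: t_def field_simps)
  qed (simp add: nrm_zero)
  then show ?thesis
    using r by (intro exI[of _ "2 / r"]) auto
qed

lemma tendsto_coordinate:
  assumes "\<And>k. u k \<in> E" "l \<in> E" "(\<lambda>k. nrm (u k - l)) \<longlonglongrightarrow> 0"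
  shows "(\<lambda>k. u k n) \<longlonglongrightarrow> l n"
proof -
  obtain M where M: "\<And>x. x \<in> E \<Longrightarrow> cmod (x n) \<le> M * nrm x"
    using coordinate_bounded by blast
  have "(\<lambda>k. u k n - l n) \<longlonglongrightarrow> 0"
  proof (rule Lim_null_comparison)
    show "\<forall>\<^sub>F k in sequentially. norm (u k n - l n) \<le> M * nrm (u k - l)"
      using M[OF diff_mem[OF assms(1,2)]] by simp
    show "(\<lambda>k. M * nrm (u k - l)) \<longlonglongrightarrow> 0"
      using tendsto_mult_right_zero[OF assms(3)] by simp
  qed
  then show ?thesis
    by (simp add: LIM_zero_iff)
qed

text \<open>
  Completeness in the form in which the closed graph theorem uses it.
\<close>

lemma dominated_geometric_series:
  assumes v: "\<And>k. v k \<in> E" and bound: "\<And>k. nrm (v k) \<le> c / 2 ^ k"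
  obtains s where "s \<in> E" "(\<lambda>n. nrm ((\<Sum>k<n. v k) - s)) \<longlonglongrightarrow> 0" "nrm s \<le> 2 * c"
proof -
  interpret M: Metric_space E "seq_dist E nrm"
    by (rule Metric_space_seq_dist)
  define S where "S n = (\<Sum>k<n. v k)" for n
  have S: "S n \<in> E" for n
    unfolding S_def by (intro sum_mem v)
  have summable: "summable (\<lambda>k. nrm (v k))"
  proof (rule summable_comparison_test')
    show "summable (\<lambda>k. c * (1 / 2) ^ k)"
      by (intro summable_mult summable_geometric) simp
    show "norm (nrm (v k)) \<le> c * (1 / 2) ^ k" if "k \<ge> 0" for k
      using bound[of k] nrm_nonneg[OF v] by (simp add: power_divide)
  qed
  have "M.MCauchy S"
    unfolding M.MCauchy_def
  proof (intro conjI allI impI)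
    show "range S \<subseteq> E"
      using S by auto
    fix e :: real assume "e > 0"
    obtain N where N: "\<And>m n. m \<ge> N \<Longrightarrow> norm (\<Sum>k=m..<n. nrm (v k)) < e"
      using summable \<open>e > 0\<close> unfolding summable_Cauchy by blast
    have *: "nrm (S n - S m) < e" if "N \<le> m" "m \<le> n" for m n
    proof -
      have "S n - S m = (\<Sum>k=m..<n. v k)"
        unfolding S_def using sum_diff_nat_ivl[of 0 m n v] that by (simp add: atLeast0LessThan)
      then have "nrm (S n - S m) \<le> (\<Sum>k=m..<n. nrm (v k))"
        using nrm_sum[of "{m..<n}" v] v by simp
      also have "\<dots> < e"
        using N[OF that(1), of n] by simp
      finally show ?thesis .
    qed
    have "seq_dist E nrm (S m) (S n) < e" if "N \<le> m" "N \<le> n" for m n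
      using *[of m n] *[of n m] that S nrm_minus_commute[OF S S, of m n]
      by (cases "m \<le> n") (auto simp: seq_dist_def)
    then show "\<exists>N. \<forall>n n'. N \<le> n \<longrightarrow> N \<le> n' \<longrightarrow> seq_dist E nrm (S n) (S n') < e"
      by blast
  qed
  then obtain s where "limitin M.mtopology S s sequentially"
    using complete unfolding M.mcomplete_def by blast
  then have s: "s \<in> E" and "(\<lambda>n. seq_dist E nrm (S n) s) \<longlonglongrightarrow> 0"
    by (auto simp: M.limitin_metric_dist_null)
  then have lim: "(\<lambda>n. nrm (S n - s)) \<longlonglongrightarrow> 0"
    using S by (simp add: seq_dist_def)
  have "nrm (S n) \<le> 2 * c" for n
  proof -
    have "c \<ge> 0"
      using bound[of 0] nrm_nonneg[OF v, of 0] by simp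
    have "nrm (S n) \<le> (\<Sum>k<n. c * (1 / 2) ^ k)"
      unfolding S_def
      by (rule order_trans[OF nrm_sum[OF v] sum_mono]) (use bound in \<open>simp add: power_divide\<close>)
    also have "\<dots> = c * (2 - 2 * (1 / 2) ^ n)"
      by (simp add: sum_distrib_left[symmetric] sum_gp_strict)
    also have "\<dots> \<le> 2 * c"
      using \<open>c \<ge> 0\<close> by (simp add: algebra_simps)
    finally show ?thesis .
  qed
  moreover have "nrm s \<le> nrm (S n - s) + nrm (S n)" for n
    using nrm_le_diff_add[OF s S, of n] nrm_minus_commute[OF s S, of n] by simp
  ultimately have "nrm s \<le> nrm (S n - s) + 2 * c" for n
    by (meson add_left_mono order_trans)
  then have "nrm s \<le> 2 * c"
    by (intro LIMSEQ_le_const[OF tendsto_add[OF lim tendsto_const, of "2 * c", simplified]]) auto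
  then show ?thesis
    using that s lim unfolding S_def by blast
qed

section \<open>Bounded operators and the closed graph theorem\<close>

lemma bounded_operatorI:
  assumes "\<And>x. x \<in> E \<Longrightarrow> T x \<in> E"
    and "\<And>x y. x \<in> E \<Longrightarrow> y \<in> E \<Longrightarrow> T (x + y) = T x + T y"
    and "\<And>c x. x \<in> E \<Longrightarrow> T (\<lambda>n. c * x n) = (\<lambda>n. c * T x n)"
    and "\<And>x. x \<in> E \<Longrightarrow> nrm (T x) \<le> K * nrm x"
  shows "bounded_operator E nrm T"
  using assms unfolding bounded_operator_def by blast

lemma bounded_operatorD:
  assumes "bounded_operator E nrm T"
  shows bounded_operator_mem: "x \<in> E \<Longrightarrow> T x \<in> E"
    and bounded_operator_add: "x \<in> E \<Longrightarrow> y \<in> E \<Longrightarrow> T (x + y) = T x + T y"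
    and bounded_operator_scale: "x \<in> E \<Longrightarrow> T (\<lambda>n. c * x n) = (\<lambda>n. c * T x n)"
  using assms unfolding bounded_operator_def by blast+

text \<open>
  A bound can always be enlarged to a positive one, which makes later divisions and
  monotonicity steps unconditional.
\<close>

lemma bounded_operator_bound:
  assumes "bounded_operator E nrm T"
  obtains K where "K > 0" "\<And>x. x \<in> E \<Longrightarrow> nrm (T x) \<le> K * nrm x"
proof -
  obtain K where K: "\<And>x. x \<in> E \<Longrightarrow> nrm (T x) \<le> K * nrm x"
    using assms unfolding bounded_operator_def by blast
  have "nrm (T x) \<le> max K 1 * nrm x" if "x \<in> E" for x
    using K[OF that] nrm_nonneg[OF that] by (smt (verit) mult_right_mono)
  then show ?thesis
    using that[of "max K 1"] by simp
qed

lemma bounded_operator_zero: "T 0 = 0" if "bounded_operator E nrm T"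
  using bounded_operator_scale[OF that zero_mem, of 0] by (simp add: zero_fun_def)

lemma bounded_operator_diff: "T (x - y) = T x - T y"
  if "bounded_operator E nrm T" "x \<in> E" "y \<in> E"
  using bounded_operator_add[OF that(1) diff_mem[OF that(2,3)] that(3)] by (simp add: algebra_simps)

lemma bounded_operator_diff_scaled: "T (\<lambda>n. x n - c * y n) = (\<lambda>n. T x n - c * T y n)"
  if "bounded_operator E nrm T" "x \<in> E" "y \<in> E"
proof -
  have eq: "(\<lambda>n. x n - c * y n) = x - (\<lambda>n. c * y n)"
    by (simp add: fun_eq_iff)
  show ?thesis
    unfolding eq bounded_operator_diff[OF that(1,2) scale_mem[OF that(3)]]
      bounded_operator_scale[OF that(1,3)]
    by (simp add: fun_eq_iff)
qed

lemma bounded_operator_sum: "T (\<Sum>i\<in>I. f i) = (\<Sum>i\<in>I. T (f i))"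
  if "bounded_operator E nrm T" "\<And>i. i \<in> I \<Longrightarrow> f i \<in> E"
  using that(2)
proof (induction I rule: infinite_finite_induct)
  case (insert i I)
  have "T (f i + sum f I) = T (f i) + T (sum f I)"
    using insert.prems by (intro bounded_operator_add[OF that(1)] sum_mem) auto
  also have "T (sum f I) = (\<Sum>i\<in>I. T (f i))"
    using insert by blast
  finally show ?case
    unfolding sum.insert[OF insert.hyps(1,2)] by simp
qed (use bounded_operator_zero[OF that(1)] in auto)

lemma bounded_operator_ident: "bounded_operator E nrm (\<lambda>x. x)"
  by (rule bounded_operatorI[where K = 1]) auto

lemma bounded_operator_compose:
  assumes A: "bounded_operator E nrm A" and B: "bounded_operator E nrm B"
  shows "bounded_operator E nrm (\<lambda>x. A (B x))"
proof -
  obtain K where K: "K > 0" "\<And>x. x \<in> E \<Longrightarrow> nrm (A x) \<le> K * nrm x"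
    using bounded_operator_bound[OF A] by blast
  obtain L where L: "L > 0" "\<And>x. x \<in> E \<Longrightarrow> nrm (B x) \<le> L * nrm x"
    using bounded_operator_bound[OF B] by blast
  note [simp] = bounded_operatorD[OF A] bounded_operatorD[OF B]
  show ?thesis
  proof (rule bounded_operatorI[where K = "K * L"])
    show "nrm (A (B x)) \<le> K * L * nrm x" if "x \<in> E" for x
      using order_trans[OF K(2)[of "B x"] mult_left_mono[OF L(2)[OF that], of K]] K(1) that
      by (simp add: mult.assoc)
  qed simp_all
qed

lemma bounded_operator_plus:
  assumes A: "bounded_operator E nrm A" and B: "bounded_operator E nrm B"
  shows "bounded_operator E nrm (\<lambda>x. A x + B x)"
proof -
  obtain K where K: "K > 0" "\<And>x. x \<in> E \<Longrightarrow> nrm (A x) \<le> K * nrm x"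
    using bounded_operator_bound[OF A] by blast
  obtain L where L: "L > 0" "\<And>x. x \<in> E \<Longrightarrow> nrm (B x) \<le> L * nrm x"
    using bounded_operator_bound[OF B] by blast
  note [simp] = bounded_operatorD[OF A] bounded_operatorD[OF B]
  show ?thesis
  proof (rule bounded_operatorI[where K = "K + L"])
    show "nrm (A x + B x) \<le> (K + L) * nrm x" if "x \<in> E" for x
      using nrm_triangle[of "A x" "B x"] K(2)[OF that] L(2)[OF that] that
      by (simp add: distrib_right)
  qed (simp_all add: add_mem fun_eq_iff algebra_simps)
qed

lemma bounded_operator_scaled:
  assumes A: "bounded_operator E nrm A"
  shows "bounded_operator E nrm (\<lambda>x n. c * A x n)"
proof -
  obtain K where K: "K > 0" "\<And>x. x \<in> E \<Longrightarrow> nrm (A x) \<le> K * nrm x"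
    using bounded_operator_bound[OF A] by blast
  note [simp] = bounded_operatorD[OF A]
  show ?thesis
  proof (rule bounded_operatorI[where K = "cmod c * K"])
    show "nrm (\<lambda>n. c * A x n) \<le> cmod c * K * nrm x" if "x \<in> E" for x
      using nrm_scale[of "A x" c] mult_left_mono[OF K(2)[OF that], of "cmod c"] that
      by (simp add: mult.assoc)
  qed (simp_all add: scale_mem fun_eq_iff algebra_simps)
qed

lemma bounded_operator_minus_scalar:
  assumes "bounded_operator E nrm A"
  shows "bounded_operator E nrm (\<lambda>x n. A x n - c * x n)"
proof -
  have "(\<lambda>x n. A x n - c * x n) = (\<lambda>x. A x + (\<lambda>n. (- c) * x n))"
    by (auto simp: fun_eq_iff)
  then show ?thesis
    using bounded_operator_plus[OF assms bounded_operator_scaled[OF bounded_operator_ident], of "- c"]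
    by metis
qed

lemma bounded_operator_funpow:
  "bounded_operator E nrm (A ^^ m)" if "bounded_operator E nrm A"
proof (induction m)
  case (Suc m)
  then show ?case
    using bounded_operator_compose[OF that Suc] by (simp add: o_def)
qed (simp add: bounded_operator_ident id_def)

text \<open>
  The closed graph theorem, with closedness replaced by the condition that every coordinate of \<open>L x\<close>
  depends boundedly on \<open>x\<close>. By the Baire category theorem, some sublevel set
  \<open>{x. \<parallel>L x\<parallel> \<le> N}\<close> is dense in a ball, which differences move to the origin. Successive
  approximation then writes each \<open>x\<close> near \<open>0\<close> as a series \<open>\<Sum>k. v\<^sub>k\<close> with
  \<open>\<parallel>L v\<^sub>k\<parallel> \<le> 2 N / 2\<^sup>k\<close>. The series \<open>\<Sum>k. L v\<^sub>k\<close> converges in norm, and its sum has the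
  same coordinates as \<open>L x\<close>.
\<close>

lemma closed_graph:
  assumes mem: "\<And>x. x \<in> E \<Longrightarrow> L x \<in> E"
    and add: "\<And>x y. x \<in> E \<Longrightarrow> y \<in> E \<Longrightarrow> L (x + y) = L x + L y"
    and scale: "\<And>c x. x \<in> E \<Longrightarrow> L (\<lambda>n. c * x n) = (\<lambda>n. c * L x n)"
    and coordinate: "\<And>n. \<exists>M. \<forall>x\<in>E. cmod (L x n) \<le> M * nrm x"
  shows "bounded_operator E nrm L"
proof -
  interpret M: Metric_space E "seq_dist E nrm"
    by (rule Metric_space_seq_dist)
  have L_diff: "L (x - y) = L x - L y" if "x \<in> E" "y \<in> E" for x y
    using add[OF diff_mem[OF that] that(2)] by (simp add: algebra_simps)
  have L_sum: "L (\<Sum>i\<in>I. f i) = (\<Sum>i\<in>I. L (f i))" if "\<And>i. f i \<in> E" for I :: "nat set" and f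
  proof (induction I rule: infinite_finite_induct)
    case (insert i I)
    have "L (f i + sum f I) = L (f i) + L (sum f I)"
      by (intro add sum_mem that)
    then show ?case
      unfolding sum.insert[OF insert.hyps(1,2)] insert.IH .
  qed (use scale[OF zero_mem, of 0] in \<open>simp_all add: zero_fun_def\<close>)
  define V where "V n = {x \<in> E. nrm (L x) \<le> real n}" for n
  have "\<exists>N. M.mtopology interior_of (M.mtopology closure_of V N) \<noteq> {}"
  proof (rule ccontr)
    assume "\<not> ?thesis"
    then have "M.mtopology interior_of \<Union>(range (\<lambda>n. M.mtopology closure_of V n)) = {}"
      by (intro M.metric_Baire_category_alt complete) auto
    moreover have "\<Union>(range (\<lambda>n. M.mtopology closure_of V n)) = E"
    proof
      show "\<Union>(range (\<lambda>n. M.mtopology closure_of V n)) \<subseteq> E"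
        by (auto simp: M.metric_closure_of)
      show "E \<subseteq> \<Union>(range (\<lambda>n. M.mtopology closure_of V n))"
      proof
        fix x assume x: "x \<in> E"
        obtain n where "nrm (L x) \<le> real n"
          using real_arch_simple by blast
        then have "x \<in> V n"
          using x by (simp add: V_def)
        then show "x \<in> \<Union>(range (\<lambda>n. M.mtopology closure_of V n))"
          using closure_of_subset[of "V n" M.mtopology] by (auto simp: V_def)
      qed
    qed
    ultimately show False
      using interior_of_topspace[of M.mtopology] zero_mem by simp
  qed
  then obtain N x0 r where x0: "x0 \<in> E" and r: "r > 0"
    and ball: "M.mball x0 r \<subseteq> M.mtopology closure_of V N"
    by (auto simp: M.metric_interior_of)
  have dense: "\<exists>v\<in>E. nrm (L v) \<le> real N \<and> nrm (x - v) < e"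
    if x: "x \<in> E" "nrm (x - x0) < r" and e: "e > 0" for x e
  proof -
    have "x \<in> M.mball x0 r"
      using x x0 nrm_minus_commute[OF x(1) x0] by (simp add: M.in_mball seq_dist_def)
    then have "x \<in> M.mtopology closure_of V N"
      using ball by blast
    then obtain v where "v \<in> V N" "v \<in> M.mball x e"
      using e by (auto simp: M.metric_closure_of)
    then show ?thesis
      by (auto simp: V_def seq_dist_def M.in_mball)
  qed
  have approx: "\<exists>v\<in>E. nrm (L v) \<le> 2 * real N \<and> nrm (x - v) < e"
    if x: "x \<in> E" "nrm x < r" and e: "e > 0" for x e
  proof -
    obtain v1 where v1: "v1 \<in> E" "nrm (L v1) \<le> real N" "nrm ((x0 + x) - v1) < e / 2"
      using dense[of "x0 + x" "e / 2"] x x0 e by (auto simp: add_mem)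
    obtain v2 where v2: "v2 \<in> E" "nrm (L v2) \<le> real N" "nrm (x0 - v2) < e / 2"
      using dense[of x0 "e / 2"] x0 e r by (auto simp: nrm_zero)
    have "nrm (L (v1 - v2)) \<le> 2 * real N"
      using nrm_triangle_diff[OF mem[OF v1(1)] mem[OF v2(1)]] v1(2) v2(2)
      by (simp add: L_diff v1(1) v2(1))
    moreover have "nrm (x - (v1 - v2)) < e"
    proof -
      have eq: "x - (v1 - v2) = ((x0 + x) - v1) - (x0 - v2)"
        by (simp add: algebra_simps)
      have "nrm (x - (v1 - v2)) \<le> nrm ((x0 + x) - v1) + nrm (x0 - v2)"
        unfolding eq by (intro nrm_triangle_diff diff_mem add_mem x x0 v1 v2)
      also have "\<dots> < e"
        using v1(3) v2(3) by linarith
      finally show ?thesis .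
    qed
    ultimately show ?thesis
      using v1(1) v2(1) diff_mem by blast
  qed
  have scaled: "\<exists>v\<in>E. nrm (L v) \<le> 2 * real N / 2 ^ k \<and> nrm (x - v) < r / 2 ^ Suc k"
    if x: "x \<in> E" "nrm x < r / 2 ^ k" for x k
  proof -
    have "nrm (\<lambda>n. 2 ^ k * x n) < r"
      using nrm_scale[OF x(1), of "2 ^ k"] x(2) by (simp add: norm_power field_simps)
    then obtain v where v: "v \<in> E" "nrm (L v) \<le> 2 * real N" "nrm ((\<lambda>n. 2 ^ k * x n) - v) < r / 2"
      using approx[OF scale_mem[OF x(1)], of "2 ^ k" "r / 2"] r by auto
    let ?v = "\<lambda>n. (1 / 2 ^ k) * v n"
    have "nrm (L ?v) \<le> 2 * real N / 2 ^ k"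
      using nrm_scale[OF mem[OF v(1)], of "1 / 2 ^ k"] v(2) unfolding scale[OF v(1)]
      by (simp add: norm_divide norm_power field_simps)
    moreover have "nrm (x - ?v) < r / 2 ^ Suc k"
    proof -
      have eq: "x - ?v = (\<lambda>n. (1 / 2 ^ k) * ((\<lambda>n. 2 ^ k * x n) - v) n)"
        by (rule ext) (simp add: field_simps)
      show ?thesis
        unfolding eq nrm_scale[OF diff_mem[OF scale_mem[OF x(1)] v(1)]]
        using v(3) by (simp add: norm_divide norm_power field_simps)
    qed
    ultimately show ?thesis
      using scale_mem[OF v(1)] by blast
  qed
  have bound: "nrm (L x) \<le> 4 * real N" if x: "x \<in> E" "nrm x < r" for x
  proof -
    \<comment> \<open>\<open>y k\<close> is the remainder after \<open>k\<close> approximation steps. The choice principle fixes only the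
      shape of each term, so the starting value is carried along in the invariant.\<close>
    have "\<exists>y. y 0 = x \<and> (\<forall>k. (y k \<in> E \<and> nrm (y k) < r / 2 ^ k) \<and>
      nrm (L (y k - y (Suc k))) \<le> 2 * real N / 2 ^ k)"
    proof -
      have "\<exists>y. \<forall>k. (y k \<in> E \<and> nrm (y k) < r / 2 ^ k \<and> (k = 0 \<longrightarrow> y k = x)) \<and>
        nrm (L (y k - y (Suc k))) \<le> 2 * real N / 2 ^ k"
      proof (rule dependent_nat_choice)
        show "\<exists>z. z \<in> E \<and> nrm z < r / 2 ^ 0 \<and> (0 = (0::nat) \<longrightarrow> z = x)"
          using x by auto
        fix z :: "nat \<Rightarrow> complex" and k :: nat
        assume z: "z \<in> E \<and> nrm z < r / 2 ^ k \<and> (k = 0 \<longrightarrow> z = x)"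
        then obtain v where "v \<in> E" "nrm (L v) \<le> 2 * real N / 2 ^ k" "nrm (z - v) < r / 2 ^ Suc k"
          using scaled by blast
        then show "\<exists>y. (y \<in> E \<and> nrm y < r / 2 ^ Suc k \<and> (Suc k = 0 \<longrightarrow> y = x)) \<and>
            nrm (L (z - y)) \<le> 2 * real N / 2 ^ k"
          using z by (intro exI[of _ "z - v"]) (auto simp: diff_mem)
      qed
      then show ?thesis
        by blast
    qed
    then obtain y where y0: "y 0 = x" and y: "\<And>k. y k \<in> E" "\<And>k. nrm (y k) < r / 2 ^ k"
      and Ly: "\<And>k. nrm (L (y k - y (Suc k))) \<le> 2 * real N / 2 ^ k"
      by auto
    let ?v = "\<lambda>k. L (y k - y (Suc k))"
    have v: "?v k \<in> E" for k
      by (intro mem diff_mem y)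
    obtain s where s: "s \<in> E" "(\<lambda>n. nrm ((\<Sum>k<n. ?v k) - s)) \<longlonglongrightarrow> 0" "nrm s \<le> 2 * (2 * real N)"
      using dominated_geometric_series[OF v Ly] by blast
    have partial: "(\<Sum>k<n. ?v k) = L x - L (y n)" for n
    proof -
      have "(\<Sum>k<n. ?v k) = L (\<Sum>k<n. y k - y (Suc k))"
        by (rule L_sum[symmetric]) (intro diff_mem y)
      also have "(\<Sum>k<n. y k - y (Suc k)) = x - y n"
        using y0 by (simp add: sum_lessThan_telescope')
      finally show ?thesis
        by (simp only: L_diff[OF x(1) y(1)])
    qed
    have "s i = L x i" for i
    proof -
      obtain K where K: "\<And>x. x \<in> E \<Longrightarrow> cmod (L x i) \<le> K * nrm x"
        using coordinate by blast
      have "(\<lambda>n. (\<Sum>k<n. ?v k) i) \<longlonglongrightarrow> s i"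
        by (rule tendsto_coordinate[OF sum_mem[OF v] s(1,2)])
      moreover have "(\<lambda>n. L (y n) i) \<longlonglongrightarrow> 0"
      proof (rule Lim_null_comparison)
        show "\<forall>\<^sub>F n in sequentially. norm (L (y n) i) \<le> (\<bar>K\<bar> * r) * (1 / 2) ^ n"
        proof (intro always_eventually allI)
          fix n
          have "cmod (L (y n) i) \<le> \<bar>K\<bar> * nrm (y n)"
            using K[OF y(1), of n] nrm_nonneg[OF y(1), of n]
            by (smt (verit) mult_right_mono)
          also have "\<dots> \<le> \<bar>K\<bar> * (r / 2 ^ n)"
            using y(2)[of n] by (intro mult_left_mono) auto
          finally show "norm (L (y n) i) \<le> (\<bar>K\<bar> * r) * (1 / 2) ^ n"
            by (simp add: power_divide)
        qed
        show "(\<lambda>n. (\<bar>K\<bar> * r) * (1 / 2) ^ n) \<longlonglongrightarrow> 0"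
          by (intro tendsto_mult_right_zero LIMSEQ_realpow_zero) auto
      qed
      then have "(\<lambda>n. (\<Sum>k<n. ?v k) i) \<longlonglongrightarrow> L x i"
        unfolding partial by (auto intro!: tendsto_eq_intros)
      ultimately show ?thesis
        using LIMSEQ_unique by blast
    qed
    then have "s = L x"
      by auto
    then show ?thesis
      using s(3) by simp
  qed
  show ?thesis
  proof (rule bounded_operatorI[where K = "8 * real N / r"])
    fix x assume x: "x \<in> E"
    show "nrm (L x) \<le> 8 * real N / r * nrm x"
    proof (cases "x = 0")
      case True
      then show ?thesis
        using scale[OF zero_mem, of 0] by (simp add: zero_fun_def[symmetric] nrm_zero)
    next
      case False
      then have pos: "nrm x > 0"
        using nrm_nonneg[OF x] nrm_eq_0_iff[OF x] by linarith
      define t where "t = r / (2 * nrm x)"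
      have t: "t > 0"
        using r pos by (simp add: t_def)
      have "t * nrm x < r"
        using r pos by (simp add: t_def)
      then have "nrm (\<lambda>m. of_real t * x m) < r"
        using nrm_scale[OF x, of "of_real t"] t by simp
      from bound[OF scale_mem[OF x] this] have "t * nrm (L x) \<le> 4 * real N"
        using nrm_scale[OF mem[OF x], of "of_real t"] t by (simp add: scale x)
      then show ?thesis
        using t pos r by (simp add: t_def field_simps)
    qed
  qed (use mem add scale in auto)
qed

lemma right_shift_bounded_operator:
  assumes "right_shift ` E \<subseteq> E"
  shows "bounded_operator E nrm right_shift"
proof (rule closed_graph)
  show "\<exists>M. \<forall>x\<in>E. cmod (right_shift x n) \<le> M * nrm x" for n
  proof (cases n)
    case 0
    then show ?thesis
      by (intro exI[of _ 0]) (simp add: right_shift_def)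
  next
    case (Suc m)
    then show ?thesis
      using coordinate_bounded[of m] by (auto simp: right_shift_def)
  qed
qed (use assms in \<open>auto simp: right_shift_def fun_eq_iff\<close>)

lemma left_shift_bounded_operator:
  assumes "left_shift ` E \<subseteq> E"
  shows "bounded_operator E nrm left_shift"
proof (rule closed_graph)
  show "\<exists>M. \<forall>x\<in>E. cmod (left_shift x n) \<le> M * nrm x" for n
    using coordinate_bounded[of "n + 1"] by (auto simp: left_shift_def)
qed (use assms in \<open>auto simp: left_shift_def fun_eq_iff\<close>)

section \<open>Inverses and spectra\<close>

text \<open>
  The equation \<open>x = y + A x\<close> is a fixed point problem for a strict contraction, so it has exactly
  one solution \<open>B y\<close>. Uniqueness makes \<open>B\<close> linear and a left inverse.
\<close>

lemma inverse_one_minus_contraction: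
  assumes A: "bounded_operator E nrm A" and q: "q < 1"
    and contraction: "\<And>x. x \<in> E \<Longrightarrow> nrm (A x) \<le> q * nrm x"
  obtains B where "bounded_operator E nrm B"
    "\<And>x. x \<in> E \<Longrightarrow> B (x - A x) = x" "\<And>x. x \<in> E \<Longrightarrow> B x - A (B x) = x"
proof -
  interpret M: Metric_space E "seq_dist E nrm"
    by (rule Metric_space_seq_dist)
  note [simp] = bounded_operatorD[OF A] bounded_operator_diff[OF A]
  have contractive: "seq_dist E nrm (y + A x) (y + A x') \<le> q * seq_dist E nrm x x'"
    if "x \<in> E" "x' \<in> E" "y \<in> E" for x x' y
    using contraction[OF diff_mem[OF that(1,2)]] that
    by (simp add: seq_dist_def add_mem)
  have ex1: "\<exists>!x. x \<in> E \<and> y + A x = x" if y: "y \<in> E" for y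
  proof -
    obtain x where x: "x \<in> E" "y + A x = x"
    proof (rule M.Banach_fixedpoint_thm[where k = q and f = "\<lambda>x. y + A x"])
      show "(\<lambda>x. y + A x) \<in> E \<rightarrow> E"
        using y by (auto intro!: add_mem)
      show "seq_dist E nrm (y + A x) (y + A x') \<le> q * seq_dist E nrm x x'" if "x \<in> E" "x' \<in> E" for x x'
        using contractive that y by blast
    qed (use zero_mem complete q in auto)
    moreover have "x' = x" if x': "x' \<in> E" "y + A x' = x'" for x'
    proof -
      have "A (x' - x) = (y + A x') - (y + A x)"
        unfolding bounded_operator_diff[OF A x'(1) x(1)] by (rule add_diff_cancel_left[symmetric])
      then have "A (x' - x) = x' - x"
        using x'(2) x(2) by simp
      then have "nrm (x' - x) \<le> q * nrm (x' - x)"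
        using contraction[OF diff_mem[OF x'(1) x(1)]] by simp
      then have "(1 - q) * nrm (x' - x) \<le> 0"
        by (simp add: algebra_simps)
      then have "nrm (x' - x) \<le> 0"
        using q by (simp add: mult_le_0_iff)
      then show ?thesis
        using nrm_nonneg[OF diff_mem[OF x'(1) x(1)]] nrm_eq_0_iff[OF diff_mem[OF x'(1) x(1)]] by simp
    qed
    ultimately show ?thesis
      by blast
  qed
  define B where "B y = (THE x. x \<in> E \<and> y + A x = x)" for y
  have B: "B y \<in> E" "y + A (B y) = B y" if "y \<in> E" for y
    using theI'[OF ex1[OF that]] unfolding B_def by auto
  have B_eqI: "B y = x" if "y \<in> E" "x \<in> E" "y + A x = x" for x y
    using ex1[OF that(1)] B[OF that(1)] that(2,3) by blast
  have "bounded_operator E nrm B"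
  proof (rule bounded_operatorI[where K = "1 / (1 - q)"])
    show "B (x + y) = B x + B y" if "x \<in> E" "y \<in> E" for x y
    proof (rule B_eqI)
      have "x + y + A (B x + B y) = (x + A (B x)) + (y + A (B y))"
        using that by (simp add: B algebra_simps)
      then show "x + y + A (B x + B y) = B x + B y"
        using that by (simp add: B)
    qed (use that B add_mem in auto)
    show "B (\<lambda>n. c * x n) = (\<lambda>n. c * B x n)" if "x \<in> E" for c x
    proof (rule B_eqI)
      have "c * x n + c * A (B x) n = c * B x n" for n
        using fun_cong[OF B(2)[OF that], of n] by (simp add: distrib_left[symmetric])
      then show "(\<lambda>n. c * x n) + A (\<lambda>n. c * B x n) = (\<lambda>n. c * B x n)"
        using that by (simp add: B fun_eq_iff)
    qed (use that B scale_mem in auto)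
    show "nrm (B x) \<le> 1 / (1 - q) * nrm x" if "x \<in> E" for x
    proof -
      have "nrm (B x) \<le> nrm x + q * nrm (B x)"
        using nrm_triangle[of x "A (B x)"] contraction[of "B x"] that B[OF that] by simp
      then show ?thesis
        using q by (simp add: field_simps)
    qed
  qed (use B in auto)
  moreover have "B (x - A x) = x" if "x \<in> E" for x
    by (rule B_eqI) (use that diff_mem in auto)
  moreover have "B x - A (B x) = x" if "x \<in> E" for x
    using B[OF that] by (metis add_diff_cancel_right')
  ultimately show ?thesis
    using that by blast
qed

text \<open>
  A left inverse and a right inverse coincide, so they may be exhibited separately and
  boundedness has to be known for one of them only.
\<close>

lemma not_in_spectrumI:
  assumes R: "bounded_operator E nrm R" and L: "\<And>x. x \<in> E \<Longrightarrow> L x \<in> E"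
    and T: "bounded_operator E nrm T"
    and left: "\<And>x. x \<in> E \<Longrightarrow> L (\<lambda>n. T x n - c * x n) = x"
    and right: "\<And>x. x \<in> E \<Longrightarrow> (\<lambda>n. T (R x) n - c * R x n) = x"
  shows "c \<notin> spectrum_on E nrm T"
proof -
  let ?Q = "\<lambda>x n. T x n - c * x n"
  have Q: "?Q x \<in> E" if "x \<in> E" for x
    using bounded_operator_mem[OF bounded_operator_minus_scalar[OF T] that] .
  have "R (?Q x) = x" if "x \<in> E" for x
    using left[OF bounded_operator_mem[OF R Q[OF that]]] right[OF Q[OF that]] left[OF that] by simp
  then show ?thesis
    unfolding spectrum_on_def using R right by blast
qed

lemma resolvent:
  assumes "c \<notin> spectrum_on E nrm T"
  obtains R where "bounded_operator E nrm R"
    "\<And>x. x \<in> E \<Longrightarrow> R (\<lambda>n. T x n - c * x n) = x"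
    "\<And>x. x \<in> E \<Longrightarrow> (\<lambda>n. T (R x) n - c * R x n) = x"
  using assms unfolding spectrum_on_def by blast

text \<open>
  Sandwich \<open>U (T - c) = (T - c) U\<close> between two copies of the inverse \<open>R\<close>.
\<close>

lemma resolvent_commutes:
  assumes T: "bounded_operator E nrm T" and U: "bounded_operator E nrm U"
    and R: "bounded_operator E nrm R"
    and left: "\<And>x. x \<in> E \<Longrightarrow> R (\<lambda>n. T x n - c * x n) = x"
    and right: "\<And>x. x \<in> E \<Longrightarrow> (\<lambda>n. T (R x) n - c * R x n) = x"
    and commute: "commute_on E T U"
  shows "commute_on E R U"
  unfolding commute_on_def
proof
  fix x assume x: "x \<in> E"
  let ?Q = "\<lambda>x n. T x n - c * x n"
  note mem = bounded_operator_mem[OF T] bounded_operator_mem[OF U] bounded_operator_mem[OF R]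
  have UQ: "U (?Q y) = ?Q (U y)" if "y \<in> E" for y
    using commute that by (simp add: bounded_operator_diff_scaled[OF U] mem commute_on_def)
  have "R (U x) = R (U (?Q (R x)))"
    using right[OF x] by simp
  also have "\<dots> = R (?Q (U (R x)))"
    by (simp only: UQ[OF mem(3)[OF x]])
  also have "\<dots> = U (R x)"
    using mem x by (intro left) auto
  finally show "R (U x) = U (R x)" .
qed

text \<open>
  If \<open>T - c\<^sub>0\<close> has the inverse \<open>R\<close>, then
  \<open>T - c = (T - c\<^sub>0) (1 - (c - c\<^sub>0) R) = (1 - (c - c\<^sub>0) R) (T - c\<^sub>0)\<close>, and the factor with \<open>R\<close> is
  invertible when \<open>\<bar>c - c\<^sub>0\<bar> \<parallel>R\<parallel> < 1\<close>.
\<close>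

lemma closed_spectrum:
  assumes T: "bounded_operator E nrm T"
  shows "closed (spectrum_on E nrm T)"
  unfolding closed_def open_dist
proof
  fix c0 assume "c0 \<in> - spectrum_on E nrm T"
  then obtain R where R: "bounded_operator E nrm R"
    and left: "\<And>x. x \<in> E \<Longrightarrow> R (\<lambda>n. T x n - c0 * x n) = x"
    and right: "\<And>x. x \<in> E \<Longrightarrow> (\<lambda>n. T (R x) n - c0 * R x n) = x"
    using resolvent[of c0 T] by auto
  obtain K where K: "K > 0" "\<And>x. x \<in> E \<Longrightarrow> nrm (R x) \<le> K * nrm x"
    using bounded_operator_bound[OF R] by blast
  have "c \<notin> spectrum_on E nrm T" if c: "dist c c0 < 1 / K" for c
  proof -
    let ?d = "c - c0"
    let ?Q = "\<lambda>x n. T x n - c0 * x n"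
    let ?A = "\<lambda>x n. ?d * R x n"
    have A: "bounded_operator E nrm ?A"
      by (rule bounded_operator_scaled[OF R])
    have Q: "bounded_operator E nrm ?Q"
      by (rule bounded_operator_minus_scalar[OF T])
    note mem = bounded_operator_mem[OF A] bounded_operator_mem[OF Q] bounded_operator_mem[OF R]
    have "nrm (?A x) \<le> (cmod ?d * K) * nrm x" if "x \<in> E" for x
      using mult_left_mono[OF K(2)[OF that], of "cmod ?d"] nrm_scale[of "R x" ?d] that mem
      by (simp add: mult.assoc)
    moreover have "cmod ?d * K < 1"
      using c K(1) by (simp add: dist_norm field_simps)
    ultimately obtain B where B: "bounded_operator E nrm B"
      and BA: "\<And>x. x \<in> E \<Longrightarrow> B (x - ?A x) = x" and AB: "\<And>x. x \<in> E \<Longrightarrow> B x - ?A (B x) = x"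
      using inverse_one_minus_contraction[OF A] by metis
    note memB = bounded_operator_mem[OF B]
    have factor_left: "(\<lambda>n. T x n - c * x n) = ?Q x - ?A (?Q x)" if "x \<in> E" for x
      using left[OF that] by (simp add: fun_eq_iff algebra_simps)
    have factor_right: "(\<lambda>n. T x n - c * x n) = ?Q (x - ?A x)" if x: "x \<in> E" for x
    proof -
      have "?Q (?A x) = (\<lambda>n. ?d * x n)"
        by (subst bounded_operator_scale[OF Q mem(3)[OF x]]) (rule ext, simp only: fun_cong[OF right[OF x]])
      then show ?thesis
        using bounded_operator_diff[OF Q x mem(1)[OF x]] by (simp add: fun_eq_iff algebra_simps)
    qed
    show ?thesis
    proof (rule not_in_spectrumI[OF _ _ T, where R = "\<lambda>x. B (R x)" and L = "\<lambda>x. R (B x)"])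
      show "bounded_operator E nrm (\<lambda>x. B (R x))"
        by (rule bounded_operator_compose[OF B R])
      show "R (B x) \<in> E" if "x \<in> E" for x
        using that mem memB by blast
      show "R (B (\<lambda>n. T x n - c * x n)) = x" if x: "x \<in> E" for x
        unfolding factor_left[OF x] BA[OF mem(2)[OF x]] by (rule left[OF x])
      show "(\<lambda>n. T (B (R x)) n - c * B (R x) n) = x" if x: "x \<in> E" for x
        unfolding factor_right[OF memB[OF mem(3)[OF x]]] AB[OF mem(3)[OF x]] by (rule right[OF x])
    qed
  qed
  then show "\<exists>e>0. \<forall>c. dist c c0 < e \<longrightarrow> c \<in> - spectrum_on E nrm T"
    using K(1) by (intro exI[of _ "1 / K"]) auto
qed

text \<open>
  The factorisation \<open>U\<^sup>m - w\<^sup>m = (U - w) P = P (U - w)\<close>, with \<open>P\<close> built by the recursion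
  \<open>P\<^sub>0 = 0\<close>, \<open>P\<^sub>m\<^sub>+\<^sub>1 = U P\<^sub>m + w\<^sup>m\<close>.
\<close>

lemma power_minus_power_factor:
  assumes U: "bounded_operator E nrm U"
  shows "\<exists>P. bounded_operator E nrm P \<and>
    (\<forall>x\<in>E. (\<lambda>n. U (P x) n - w * P x n) = (\<lambda>n. (U ^^ m) x n - w ^ m * x n) \<and>
           P (\<lambda>n. U x n - w * x n) = (\<lambda>n. (U ^^ m) x n - w ^ m * x n))"
proof (induction m)
  case 0
  have "bounded_operator E nrm (\<lambda>x. 0)"
    by (rule bounded_operatorI[where K = 0]) (auto simp: zero_mem nrm_zero fun_eq_iff)
  moreover have "U (\<lambda>n. 0) = (\<lambda>n. 0)"
    using bounded_operator_zero[OF U] by (simp add: zero_fun_def)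
  ultimately show ?case
    by (intro exI[of _ "\<lambda>x. 0"]) (auto simp: zero_fun_def)
next
  case (Suc m)
  let ?Q = "\<lambda>x n. U x n - w * x n"
  let ?D = "\<lambda>m x n. (U ^^ m) x n - w ^ m * x n"
  obtain P where P: "bounded_operator E nrm P"
    and QP: "\<And>x. x \<in> E \<Longrightarrow> ?Q (P x) = ?D m x" and PQ: "\<And>x. x \<in> E \<Longrightarrow> P (?Q x) = ?D m x"
    using Suc.IH by blast
  let ?P = "\<lambda>x. U (P x) + (\<lambda>n. w ^ m * x n)"
  have Um: "bounded_operator E nrm (U ^^ m)"
    by (rule bounded_operator_funpow[OF U])
  note memU = bounded_operator_mem[OF U] and memP = bounded_operator_mem[OF P]
    and memm = bounded_operator_mem[OF Um]
  have UD: "U (?D m x) = (\<lambda>n. (U ^^ Suc m) x n - w ^ m * U x n)" if "x \<in> E" for x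
    using that memm by (simp add: bounded_operator_diff_scaled[OF U])
  have UQ: "U (?Q y) = ?Q (U y)" if "y \<in> E" for y
    using that memU by (simp add: bounded_operator_diff_scaled[OF U])
  have "bounded_operator E nrm ?P"
    by (intro bounded_operator_plus bounded_operator_compose[OF U P] bounded_operator_scaled
        bounded_operator_ident)
  moreover have "?Q (?P x) = ?D (Suc m) x" if x: "x \<in> E" for x
  proof -
    have "U (?P x) = U (U (P x)) + (\<lambda>n. w ^ m * U x n)"
      using x memU memP
      by (simp add: bounded_operator_add[OF U] bounded_operator_scale[OF U] scale_mem)
    then have "?Q (?P x) = ?Q (U (P x)) + (\<lambda>n. w ^ m * ?Q x n)"
      by (simp add: fun_eq_iff algebra_simps)
    also have "\<dots> = ?D (Suc m) x"
      unfolding UQ[OF memP[OF x], symmetric] QP[OF x] UD[OF x]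
      by (simp add: fun_eq_iff algebra_simps)
    finally show ?thesis .
  qed
  moreover have "?P (?Q x) = ?D (Suc m) x" if x: "x \<in> E" for x
    unfolding PQ[OF x] UD[OF x] by (simp add: fun_eq_iff algebra_simps)
  ultimately show ?case
    by (intro exI[of _ ?P]) blast
qed

lemma unit_seq_mem: "unit_seq k \<in> E"
  using finite_support_subset by (auto simp: finite_support_def unit_seq_def)

text \<open>
  A quantitative form of \<open>\<parallel>U\<^sup>m\<parallel> \<ge> \<bar>w\<bar>\<^sup>m\<close> for spectral points \<open>w\<close>. If the conclusion failed,
  \<open>U\<^sup>m / w\<^sup>m\<close> would be a strict contraction, so \<open>U\<^sup>m - w\<^sup>m\<close> and with it the factor \<open>U - w\<close> would be
  invertible. Carrying the factor \<open>a\<close> along avoids operator norms.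
\<close>

lemma spectrum_growth:
  assumes U: "bounded_operator E nrm U" and w: "w \<in> spectrum_on E nrm U"
    and bound: "\<And>x. x \<in> E \<Longrightarrow> cmod a * nrm ((U ^^ m) x) \<le> M * nrm x"
  shows "cmod a * cmod w ^ m \<le> M"
proof (rule ccontr)
  assume "\<not> ?thesis"
  then have less: "M < cmod a * cmod w ^ m"
    by simp
  have Um: "bounded_operator E nrm (U ^^ m)"
    by (rule bounded_operator_funpow[OF U])
  have "M \<ge> 0"
  proof -
    have "unit_seq 0 \<noteq> 0"
    proof
      assume "unit_seq 0 = 0"
      then have "unit_seq 0 0 = 0"
        by (simp only: zero_fun_apply)
      then show False
        by (simp add: unit_seq_def)
    qed
    then have "nrm (unit_seq 0) > 0"
      using nrm_nonneg[OF unit_seq_mem, of 0] nrm_eq_0_iff[OF unit_seq_mem, of 0] by linarith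
    moreover have "0 \<le> cmod a * nrm ((U ^^ m) (unit_seq 0))"
      by (intro mult_nonneg_nonneg nrm_nonneg bounded_operator_mem[OF Um] unit_seq_mem norm_ge_zero)
    then have "0 \<le> M * nrm (unit_seq 0)"
      using bound[OF unit_seq_mem, of 0] by linarith
    ultimately show ?thesis
      by (simp add: zero_le_mult_iff)
  qed
  define b where "b = w ^ m"
  have b_growth: "cmod a * cmod b > M"
    using less by (simp add: b_def norm_power)
  then have b: "b \<noteq> 0" and prod_pos: "cmod a * cmod b > 0"
    using \<open>M \<ge> 0\<close> by auto
  then have a: "cmod a > 0"
    by (simp add: zero_less_mult_iff)
  let ?A = "\<lambda>x n. (1 / b) * (U ^^ m) x n"
  have A: "bounded_operator E nrm ?A"
    by (rule bounded_operator_scaled[OF Um])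
  have "nrm (?A x) \<le> (M / (cmod a * cmod b)) * nrm x" if "x \<in> E" for x
  proof -
    have "nrm (?A x) = (cmod a * nrm ((U ^^ m) x)) / (cmod a * cmod b)"
      unfolding nrm_scale[OF bounded_operator_mem[OF Um that]] using a by (simp add: norm_divide)
    also have "\<dots> \<le> (M * nrm x) / (cmod a * cmod b)"
      using bound[OF that] prod_pos by (intro divide_right_mono) auto
    finally show ?thesis
      by simp
  qed
  moreover have "M / (cmod a * cmod b) < 1"
    using b_growth prod_pos by simp
  ultimately obtain B where B: "bounded_operator E nrm B"
    and BA: "\<And>x. x \<in> E \<Longrightarrow> B (x - ?A x) = x" and AB: "\<And>x. x \<in> E \<Longrightarrow> B x - ?A (B x) = x"
    using inverse_one_minus_contraction[OF A] by metis
  obtain P where P: "bounded_operator E nrm P"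
    and QP: "\<And>x. x \<in> E \<Longrightarrow> (\<lambda>n. U (P x) n - w * P x n) = (\<lambda>n. (U ^^ m) x n - b * x n)"
    and PQ: "\<And>x. x \<in> E \<Longrightarrow> P (\<lambda>n. U x n - w * x n) = (\<lambda>n. (U ^^ m) x n - b * x n)"
    using power_minus_power_factor[OF U, of w m] unfolding b_def by blast
  have D: "(\<lambda>n. (U ^^ m) x n - b * x n) = (\<lambda>n. (- b) * (x - ?A x) n)" for x
    using b by (simp add: fun_eq_iff field_simps)
  note mem = bounded_operator_mem[OF B] bounded_operator_mem[OF P] bounded_operator_mem[OF A]
  have "w \<notin> spectrum_on E nrm U"
  proof (rule not_in_spectrumI[OF _ _ U, where R = "\<lambda>x n. (- 1 / b) * P (B x) n"
        and L = "\<lambda>x n. (- 1 / b) * B (P x) n"])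
    show "bounded_operator E nrm (\<lambda>x n. (- 1 / b) * P (B x) n)"
      by (intro bounded_operator_scaled bounded_operator_compose[OF P B])
    show "(\<lambda>n. (- 1 / b) * B (P x) n) \<in> E" if "x \<in> E" for x
      by (intro scale_mem mem that)
    show "(\<lambda>n. (- 1 / b) * B (P (\<lambda>n. U x n - w * x n)) n) = x" if x: "x \<in> E" for x
      unfolding PQ[OF x] D bounded_operator_scale[OF B diff_mem[OF x mem(3)[OF x]]] BA[OF x]
      using b by (simp add: fun_eq_iff)
    show "(\<lambda>n. U (\<lambda>n. (- 1 / b) * P (B x) n) n - w * ((- 1 / b) * P (B x) n)) = x"
      if x: "x \<in> E" for x
    proof -
      have QPB: "(\<lambda>n. U (P (B x)) n - w * P (B x) n) = (\<lambda>n. (- b) * x n)"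
        unfolding QP[OF mem(1)[OF x]] D AB[OF x] ..
      have "(- 1 / b) * U (P (B x)) n - w * ((- 1 / b) * P (B x) n) = x n" for n
      proof -
        have "(- 1 / b) * U (P (B x)) n - w * ((- 1 / b) * P (B x) n)
          = (- 1 / b) * (U (P (B x)) n - w * P (B x) n)"
          by (simp add: algebra_simps)
        also have "\<dots> = x n"
          using fun_cong[OF QPB, of n] b by simp
        finally show ?thesis .
      qed
      then show ?thesis
        unfolding bounded_operator_scale[OF U mem(2)[OF mem(1)[OF x]]] by (intro ext)
    qed
  qed
  then show False
    using w by blast
qed

section \<open>Averaging over rotations\<close>

lemma bounded_operator_expansion:
  assumes T: "bounded_operator E nrm T" and x: "finite {n. x n \<noteq> 0}"
  shows "T x = (\<Sum>j | x j \<noteq> 0. (\<lambda>n. x j * T (unit_seq j) n))"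
proof -
  have "T x = T (\<Sum>j | x j \<noteq> 0. (\<lambda>n. x j * unit_seq j n))"
    by (rule arg_cong[OF finite_support_expansion[OF x]])
  also have "\<dots> = (\<Sum>j | x j \<noteq> 0. T (\<lambda>n. x j * unit_seq j n))"
    by (intro bounded_operator_sum[OF T] scale_mem unit_seq_mem)
  also have "\<dots> = (\<Sum>j | x j \<noteq> 0. (\<lambda>n. x j * T (unit_seq j) n))"
    by (intro sum.cong refl bounded_operator_scale[OF T] unit_seq_mem)
  finally show ?thesis .
qed

lemma average_bound:
  assumes N: "N > 0" and f: "\<And>i. f i \<in> E" and bound: "\<And>i. nrm (f i) \<le> B"
    and c: "\<And>i. cmod (c i) = 1"
  shows "(\<lambda>m. (1 / of_nat N) * (\<Sum>i<N. (\<lambda>m. c i * f i m)) m) \<in> E"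
    and "nrm (\<lambda>m. (1 / of_nat N) * (\<Sum>i<N. (\<lambda>m. c i * f i m)) m) \<le> B"
proof -
  let ?s = "\<Sum>i<N. (\<lambda>m. c i * f i m)"
  have s: "?s \<in> E"
    by (intro sum_mem scale_mem f)
  then show "(\<lambda>m. (1 / of_nat N) * ?s m) \<in> E"
    by (rule scale_mem)
  have "nrm ?s \<le> (\<Sum>i<N. nrm (\<lambda>m. c i * f i m))"
    by (intro nrm_sum scale_mem f)
  also have "\<dots> = (\<Sum>i<N. nrm (f i))"
    by (simp add: nrm_scale f c)
  also have "\<dots> \<le> real N * B"
    using sum_mono[of "{..<N}" "\<lambda>i. nrm (f i)" "\<lambda>i. B"] bound by simp
  finally show "nrm (\<lambda>m. (1 / of_nat N) * ?s m) \<le> B"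
    unfolding nrm_scale[OF s] using N by (simp add: norm_divide field_simps)
qed

lemma rotation_bound:
  obtains C where "C > 0" "\<And>z x. cmod z = 1 \<Longrightarrow> x \<in> E \<Longrightarrow> nrm (rotation z x) \<le> C * nrm x"
proof -
  obtain C where C: "\<And>z x. cmod z = 1 \<Longrightarrow> x \<in> E \<Longrightarrow> nrm (rotation z x) \<le> C * nrm x"
    using rotation_bounded by blast
  have "nrm (rotation z x) \<le> max C 1 * nrm x" if "cmod z = 1" "x \<in> E" for z x
    using order_trans[OF C[OF that] mult_right_mono[OF max.cobounded1 nrm_nonneg[OF that(2)]]] .
  then show ?thesis
    using that[of "max C 1"] by simp
qed

lemma coordinate_part_mem: "coordinate_part k u \<in> E"
  unfolding coordinate_part_eq_unit_seq by (intro scale_mem unit_seq_mem)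

lemma coordinate_part_bound:
  obtains D where "D \<ge> 0" "\<And>u. u \<in> E \<Longrightarrow> nrm (coordinate_part k u) \<le> D * nrm u"
proof -
  obtain M where M: "M \<ge> 0" "\<And>u. u \<in> E \<Longrightarrow> cmod (u (nat k)) \<le> M * nrm u"
    using coordinate_bounded by blast
  let ?e = "nrm (unit_seq (nat k))"
  have e: "?e \<ge> 0"
    by (intro nrm_nonneg unit_seq_mem)
  have "nrm (coordinate_part k u) \<le> (M * ?e) * nrm u" if u: "u \<in> E" for u
  proof -
    have "nrm (coordinate_part k u) = cmod (if 0 \<le> k then u (nat k) else 0) * ?e"
      unfolding coordinate_part_eq_unit_seq by (rule nrm_scale[OF unit_seq_mem])
    also have "\<dots> \<le> (M * nrm u) * ?e"
      using M(2)[OF u] order_trans[OF norm_ge_zero M(2)[OF u]] e by (intro mult_right_mono) auto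
    finally show ?thesis
      by (simp add: mult_ac)
  qed
  then show ?thesis
    using that[of "M * ?e"] M(1) e by simp
qed

text \<open>
  On a finitely supported sequence the two projections agree once \<open>N\<close> is large. The general case
  follows by density, because the projections are bounded uniformly in \<open>N\<close>. The index \<open>Suc N\<close> keeps
  the modulus positive.
\<close>

lemma progression_part_tendsto:
  assumes u: "u \<in> E"
  shows "(\<lambda>N. nrm (progression_part (Suc N) k u - coordinate_part k u)) \<longlonglongrightarrow> 0"
proof (rule LIMSEQ_I)
  obtain C where C: "C > 0" "\<And>z x. cmod z = 1 \<Longrightarrow> x \<in> E \<Longrightarrow> nrm (rotation z x) \<le> C * nrm x"
    using rotation_bound by blast
  obtain D where D: "D \<ge> 0" "\<And>u. u \<in> E \<Longrightarrow> nrm (coordinate_part k u) \<le> D * nrm u"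
    using coordinate_part_bound[of k] by blast
  have P: "progression_part (Suc N) k v \<in> E" "nrm (progression_part (Suc N) k v) \<le> C * nrm v"
    if v: "v \<in> E" for N v
  proof -
    show "progression_part (Suc N) k v \<in> E"
      unfolding progression_part_average[OF zero_less_Suc]
      by (rule average_bound(1)[where B = "C * nrm v"]) (simp_all add: v C rotation_mem norm_power_int)
    show "nrm (progression_part (Suc N) k v) \<le> C * nrm v"
      unfolding progression_part_average[OF zero_less_Suc]
      by (rule average_bound(2)) (simp_all add: v C rotation_mem norm_power_int)
  qed
  fix e :: real assume e: "e > 0"
  obtain p where p: "p \<in> finite_support" "p \<in> E" "nrm (u - p) < e / (C + D)"
    using finite_support_approx[OF u, of "e / (C + D)"] e C(1) D(1) by (auto simp: add_pos_nonneg)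
  from p(1) have "finite {n. p n \<noteq> 0}"
    by (simp add: finite_support_def)
  then obtain b where b: "\<And>n. p n \<noteq> 0 \<Longrightarrow> n \<le> b"
    using finite_nat_set_iff_bounded_le by auto
  \<comment> \<open>All coordinates of \<open>p\<close> beyond \<open>b\<close> vanish, so a nonzero multiple of \<open>Suc N\<close> cannot be reached.\<close>
  have exact: "progression_part (Suc N) k p = coordinate_part k p" if N: "N \<ge> b + nat \<bar>k\<bar>" for N
  proof
    fix m
    have "int m = k" if "m \<le> b" "int (Suc N) dvd int m - k"
    proof (rule ccontr)
      assume "int m \<noteq> k"
      then have "int (Suc N) \<le> \<bar>int m - k\<bar>"
        using dvd_imp_le_int[of "int m - k" "int (Suc N)"] that(2) by simp
      then show False
        using that(1) N by linarith
    qed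
    then show "progression_part (Suc N) k p m = coordinate_part k p m"
      using b[of m] by (cases "p m = 0") (auto simp: progression_part_def coordinate_part_def)
  qed
  have "norm (nrm (progression_part (Suc N) k u - coordinate_part k u) - 0) < e"
    if N: "N \<ge> b + nat \<bar>k\<bar>" for N
  proof -
    have up: "u - p \<in> E"
      by (rule diff_mem[OF u p(2)])
    have eq: "progression_part (Suc N) k u - coordinate_part k u
      = progression_part (Suc N) k (u - p) - coordinate_part k (u - p)"
    proof
      fix m
      show "(progression_part (Suc N) k u - coordinate_part k u) m
        = (progression_part (Suc N) k (u - p) - coordinate_part k (u - p)) m"
        using fun_cong[OF exact[OF N], of m]
        by (cases "int (Suc N) dvd int m - k"; cases "int m = k")
          (simp_all add: progression_part_def coordinate_part_def)
    qed
    have "nrm (progression_part (Suc N) k u - coordinate_part k u)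
      \<le> nrm (progression_part (Suc N) k (u - p)) + nrm (coordinate_part k (u - p))"
      unfolding eq by (intro nrm_triangle_diff P coordinate_part_mem up)
    also have "\<dots> \<le> C * nrm (u - p) + D * nrm (u - p)"
      by (intro add_mono P D up)
    also have "\<dots> = (C + D) * nrm (u - p)"
      by (simp add: distrib_right)
    also have "\<dots> < e"
      using p(3) C(1) D(1) by (simp add: field_simps add_pos_nonneg)
    finally show ?thesis
      using nrm_nonneg[OF diff_mem[OF P(1)[OF u] coordinate_part_mem], of N k u] by simp
  qed
  then show "\<exists>no. \<forall>n\<ge>no. norm (nrm (progression_part (Suc n) k u - coordinate_part k u) - 0) < e"
    by blast
qed

text \<open>
  Conjugation by the rotation by \<open>z\<close> multiplies the part of \<open>T\<close> that raises degrees by \<open>d\<close> with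
  \<open>z\<^sup>d\<close>. The average over the \<open>N\<close>-th roots of unity against \<open>z\<^sup>-\<^sup>n\<close> keeps the parts with
  \<open>d \<equiv> n (mod N)\<close>.
\<close>

lemma rotated_operator_average:
  assumes T: "bounded_operator E nrm T" and N: "N > 0" and x: "finite {n. x n \<noteq> 0}"
  shows "(\<Sum>j | x j \<noteq> 0. (\<lambda>m. x j * progression_part N (n + int j) (T (unit_seq j)) m))
    = (\<lambda>m. (1 / of_nat N) * (\<Sum>i<N. (\<lambda>m. unity_root N i powi (- n) *
        rotation (unity_root N i) (T (rotation (inverse (unity_root N i)) x)) m)) m)"
proof
  fix m
  let ?J = "{j. x j \<noteq> 0}"
  let ?z = "unity_root N"
  have rot: "T (rotation (inverse (?z i)) x) = (\<Sum>j\<in>?J. (\<lambda>m. ?z i powi (- int j) * x j * T (unit_seq j) m))"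
    for i
  proof -
    have entry: "rotation (inverse (?z i)) x j = ?z i powi (- int j) * x j" for j
      by (simp add: rotation_def power_int_minus power_inverse)
    have supp: "{j. rotation (inverse (?z i)) x j \<noteq> 0} = ?J"
      by (auto simp: rotation_def)
    have "finite {j. rotation (inverse (?z i)) x j \<noteq> 0}"
      unfolding supp by (rule x)
    from bounded_operator_expansion[OF T this]
    have "T (rotation (inverse (?z i)) x)
      = (\<Sum>j\<in>?J. (\<lambda>m. rotation (inverse (?z i)) x j * T (unit_seq j) m))"
      unfolding supp .
    also have "\<dots> = (\<Sum>j\<in>?J. (\<lambda>m. ?z i powi (- int j) * x j * T (unit_seq j) m))"
      by (intro sum.cong refl ext arg_cong2[where f = "(*)"] entry)
    finally show ?thesis .
  qed
  have "(\<Sum>i<N. (\<lambda>m. ?z i powi (- n) * rotation (?z i) (T (rotation (inverse (?z i)) x)) m)) m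
    = (\<Sum>i<N. \<Sum>j\<in>?J. ?z i powi (int m - (n + int j)) * (x j * T (unit_seq j) m))"
    unfolding sum_seq_apply rot unfolding sum_seq_apply rotation_def sum_distrib_left
  proof (intro sum.cong refl)
    fix i j
    have "?z i powi (int m - (n + int j)) = ?z i powi ((- n + int m) + (- int j))"
      by (simp add: algebra_simps)
    also have "\<dots> = ?z i powi (- n) * ?z i powi (int m) * ?z i powi (- int j)"
      by (simp only: power_int_add unity_root_nonzero simp_thms)
    finally have "?z i powi (int m - (n + int j)) = ?z i powi (- n) * ?z i powi (int m) * ?z i powi (- int j)" .
    then show "?z i powi (- n) * (?z i ^ m * (?z i powi (- int j) * x j * T (unit_seq j) m))
      = ?z i powi (int m - (n + int j)) * (x j * T (unit_seq j) m)"
      by simp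
  qed
  also have "\<dots> = (\<Sum>j\<in>?J. (\<Sum>i<N. ?z i powi (int m - (n + int j))) * (x j * T (unit_seq j) m))"
    unfolding sum_distrib_right by (rule sum.swap)
  also have "\<dots> = of_nat N * (\<Sum>j\<in>?J. (\<lambda>m. x j * progression_part N (n + int j) (T (unit_seq j)) m)) m"
    unfolding sum_unity_root_powi[OF N] sum_seq_apply sum_distrib_left
    by (intro sum.cong refl) (simp add: progression_part_def)
  finally have total: "(\<Sum>i<N. (\<lambda>m. ?z i powi (- n) * rotation (?z i) (T (rotation (inverse (?z i)) x)) m)) m
    = of_nat N * (\<Sum>j\<in>?J. (\<lambda>m. x j * progression_part N (n + int j) (T (unit_seq j)) m)) m" .
  have "b = (1 / of_nat N) * a" if "a = of_nat N * b" for a b :: complex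
    using that N by simp
  from this[OF total]
  show "(\<Sum>j\<in>?J. (\<lambda>m. x j * progression_part N (n + int j) (T (unit_seq j)) m)) m
    = (1 / of_nat N) * (\<Sum>i<N. (\<lambda>m. ?z i powi (- n) *
        rotation (?z i) (T (rotation (inverse (?z i)) x)) m)) m" .
qed

text \<open>
  The part of \<open>T\<close> that raises degrees by exactly \<open>n\<close>, here given as \<open>a W\<close>, inherits a bound from \<open>T\<close>
  that depends neither on \<open>n\<close> nor on \<open>W\<close>. On finitely supported sequences it is the norm limit of the
  averages above as \<open>N\<close> grows, and each average is bounded by the bound of \<open>T\<close> and that of the
  rotations, the latter used twice. Density and boundedness of \<open>W\<close> extend the estimate to all of \<open>E\<close>.
\<close>

lemma homogeneous_component_bound:
  assumes T: "bounded_operator E nrm T"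
  shows "\<exists>M. \<forall>n a W. bounded_operator E nrm W \<longrightarrow>
    (\<forall>j. coordinate_part (n + int j) (T (unit_seq j)) = (\<lambda>m. a * W (unit_seq j) m)) \<longrightarrow>
    (\<forall>x\<in>E. cmod a * nrm (W x) \<le> M * nrm x)"
proof -
  obtain C where C: "C > 0" "\<And>z x. cmod z = 1 \<Longrightarrow> x \<in> E \<Longrightarrow> nrm (rotation z x) \<le> C * nrm x"
    using rotation_bound by blast
  obtain K where K: "K > 0" "\<And>x. x \<in> E \<Longrightarrow> nrm (T x) \<le> K * nrm x"
    using bounded_operator_bound[OF T] by blast
  define M where "M = C * K * C"
  have M: "M > 0"
    using C K by (simp add: M_def)
  have "cmod a * nrm (W x) \<le> M * nrm x"
    if W: "bounded_operator E nrm W"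
      and comp: "\<And>j. coordinate_part (n + int j) (T (unit_seq j)) = (\<lambda>m. a * W (unit_seq j) m)"
      and x: "x \<in> E" for n a W x
  proof -
    have finite_case: "cmod a * nrm (W p) \<le> M * nrm p" if p: "p \<in> finite_support" for p
    proof -
      have pE: "p \<in> E"
        using p finite_support_subset by blast
      have fin: "finite {n. p n \<noteq> 0}"
        using p by (simp add: finite_support_def)
      let ?J = "{j. p j \<noteq> 0}"
      let ?V = "\<lambda>N. \<Sum>j\<in>?J. (\<lambda>m. p j * progression_part (Suc N) (n + int j) (T (unit_seq j)) m)"
      have rotated: "nrm (rotation z (T (rotation (inverse z) p))) \<le> M * nrm p"
        "rotation z (T (rotation (inverse z) p)) \<in> E" if z: "cmod z = 1" for z
      proof -
        have z': "cmod (inverse z) = 1"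
          using z by (simp add: norm_inverse)
        note r = rotation_mem[OF z' pE]
        note t = bounded_operator_mem[OF T r]
        show "rotation z (T (rotation (inverse z) p)) \<in> E"
          by (rule rotation_mem[OF z t])
        have "nrm (rotation z (T (rotation (inverse z) p))) \<le> C * nrm (T (rotation (inverse z) p))"
          by (rule C(2)[OF z t])
        also have "\<dots> \<le> C * (K * nrm (rotation (inverse z) p))"
          using K(2)[OF r] C(1) by (intro mult_left_mono) auto
        also have "\<dots> \<le> C * (K * (C * nrm p))"
          using C(2)[OF z' pE] C(1) K(1) by (intro mult_left_mono) auto
        finally show "nrm (rotation z (T (rotation (inverse z) p))) \<le> M * nrm p"
          by (simp add: M_def mult_ac)
      qed
      have V: "?V N \<in> E" "nrm (?V N) \<le> M * nrm p" for N
      proof -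
        show "?V N \<in> E"
          unfolding rotated_operator_average[OF T zero_less_Suc fin]
          by (rule average_bound(1)[where B = "M * nrm p"]) (simp_all add: rotated norm_power_int)
        show "nrm (?V N) \<le> M * nrm p"
          unfolding rotated_operator_average[OF T zero_less_Suc fin]
          by (rule average_bound(2)) (simp_all add: rotated norm_power_int)
      qed
      have limit: "(\<lambda>m. a * W p m) = (\<Sum>j\<in>?J. (\<lambda>m. p j * coordinate_part (n + int j) (T (unit_seq j)) m))"
        unfolding comp bounded_operator_expansion[OF W fin]
        by (rule ext) (simp add: sum_seq_apply sum_distrib_left mult_ac)
      let ?d = "\<lambda>N j. progression_part (Suc N) (n + int j) (T (unit_seq j)) -
          coordinate_part (n + int j) (T (unit_seq j))"
      have prog_mem: "progression_part (Suc N) k v \<in> E" if v: "v \<in> E" for N k v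
        unfolding progression_part_average[OF zero_less_Suc]
        by (intro scale_mem sum_mem rotation_mem v norm_unity_root)
      have d: "?d N j \<in> E" for N j
        by (intro diff_mem prog_mem coordinate_part_mem bounded_operator_mem[OF T] unit_seq_mem)
      have close: "cmod a * nrm (W p) \<le> M * nrm p + (\<Sum>j\<in>?J. cmod (p j) * nrm (?d N j))" for N
      proof -
        let ?aW = "\<lambda>m. a * W p m"
        have aW: "?aW \<in> E"
          by (intro scale_mem bounded_operator_mem[OF W] pE)
        have diff: "?V N - ?aW = (\<Sum>j\<in>?J. (\<lambda>m. p j * ?d N j m))"
          unfolding limit
          by (rule ext) (simp add: sum_seq_apply sum_subtractf[symmetric] right_diff_distrib)
        have "nrm (?V N - ?aW) \<le> (\<Sum>j\<in>?J. nrm (\<lambda>m. p j * ?d N j m))"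
          unfolding diff by (intro nrm_sum scale_mem d)
        also have "\<dots> = (\<Sum>j\<in>?J. cmod (p j) * nrm (?d N j))"
          by (intro sum.cong refl nrm_scale d)
        finally have "nrm ?aW \<le> (\<Sum>j\<in>?J. cmod (p j) * nrm (?d N j)) + nrm (?V N)"
          using nrm_le_diff_add[OF aW V(1), of N] nrm_minus_commute[OF aW V(1), of N] by linarith
        then show ?thesis
          using V(2)[of N] nrm_scale[OF bounded_operator_mem[OF W pE], of a] by linarith
      qed
      have "(\<lambda>N. M * nrm p + (\<Sum>j\<in>?J. cmod (p j) * nrm (?d N j))) \<longlonglongrightarrow>
          M * nrm p + (\<Sum>j\<in>?J. cmod (p j) * 0)"
        by (intro tendsto_intros progression_part_tendsto bounded_operator_mem[OF T] unit_seq_mem)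
      then show ?thesis
        using close by (intro LIMSEQ_le_const[of _ "M * nrm p"]) auto
    qed
    obtain L where L: "L > 0" "\<And>x. x \<in> E \<Longrightarrow> nrm (W x) \<le> L * nrm x"
      using bounded_operator_bound[OF W] by blast
    show ?thesis
    proof (rule field_le_epsilon)
      fix e :: real assume e: "e > 0"
      \<comment> \<open>The error of the approximation enters once through \<open>a W\<close> and once through the bound \<open>M\<close>.\<close>
      define \<delta> where "\<delta> = e / (M + cmod a * L)"
      have den: "M + cmod a * L > 0"
        using M L(1) by (simp add: add_pos_nonneg)
      obtain p where p: "p \<in> finite_support" "p \<in> E" "nrm (x - p) < \<delta>"
        using finite_support_approx[OF x, of \<delta>] e den by (auto simp: \<delta>_def)
      have "nrm (W x) \<le> nrm (W (x - p)) + nrm (W p)"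
        using nrm_le_diff_add[OF bounded_operator_mem[OF W x] bounded_operator_mem[OF W p(2)]]
        by (simp only: bounded_operator_diff[OF W x p(2)])
      also have "\<dots> \<le> L * \<delta> + nrm (W p)"
        using L(2)[OF diff_mem[OF x p(2)]] mult_left_mono[of "nrm (x - p)" \<delta> L] L(1) p(3) by linarith
      finally have "cmod a * nrm (W x) \<le> cmod a * (L * \<delta> + nrm (W p))"
        by (intro mult_left_mono) auto
      also have "\<dots> \<le> cmod a * L * \<delta> + M * nrm p"
        using finite_case[OF p(1)] by (simp add: distrib_left)
      also have "M * nrm p \<le> M * (\<delta> + nrm x)"
        using nrm_le_diff_add[OF p(2) x] nrm_minus_commute[OF x p(2)] p(3) M by (intro mult_left_mono) auto
      also have "cmod a * L * \<delta> + M * (\<delta> + nrm x) = (M + cmod a * L) * \<delta> + M * nrm x"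
        by (simp add: algebra_simps)
      also have "(M + cmod a * L) * \<delta> = e"
        using den by (simp add: \<delta>_def)
      finally show "cmod a * nrm (W x) \<le> M * nrm x + e"
        by simp
    qed
  qed
  then show ?thesis
    by blast
qed

section \<open>Symbols of operators commuting with a shift\<close>

text \<open>
  The argument common to both shifts. The coefficients \<open>\<tau> T n\<close> of an operator commuting with \<open>U\<close> enter
  through two properties: the bound on \<open>\<tau> T n U\<^sup>n\<close> and the Cauchy product rule for an operator and its
  resolvent.
\<close>

lemma spectral_inclusion_of_symbol:
  assumes U: "bounded_operator E nrm U"
    and growth: "\<And>T. bounded_operator E nrm T \<Longrightarrow> commute_on E T U \<Longrightarrow>
      \<exists>M. \<forall>n. \<forall>x\<in>E. cmod (\<tau> T n) * nrm ((U ^^ n) x) \<le> M * nrm x"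
    and product: "\<And>T R c n. bounded_operator E nrm T \<Longrightarrow> commute_on E T U \<Longrightarrow>
      bounded_operator E nrm R \<Longrightarrow> commute_on E R U \<Longrightarrow>
      (\<And>x. x \<in> E \<Longrightarrow> (\<lambda>n. T (R x) n - c * R x n) = x) \<Longrightarrow>
      (\<Sum>k\<le>n. \<tau> T k * \<tau> R (n - k)) - c * \<tau> R n = (if n = 0 then 1 else 0)"
    and T: "bounded_operator E nrm T" and commute: "commute_on E T U"
  shows "\<And>z. z \<in> interior (spectrum_on E nrm U) \<Longrightarrow> summable (\<lambda>n. norm (\<tau> T n * z ^ n))"
    and "closure ((\<lambda>z. \<Sum>n. \<tau> T n * z ^ n) ` interior (spectrum_on E nrm U)) \<subseteq> spectrum_on E nrm T"
proof -
  have summable: "summable (\<lambda>n. norm (\<tau> A n * z ^ n))"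
    if A: "bounded_operator E nrm A" "commute_on E A U"
      and z: "z \<in> interior (spectrum_on E nrm U)" for A z
  proof -
    obtain w where w: "w \<in> spectrum_on E nrm U" "cmod z < cmod w"
      using interior_point_larger_norm[OF z] by blast
    obtain M where M: "\<And>n x. x \<in> E \<Longrightarrow> cmod (\<tau> A n) * nrm ((U ^^ n) x) \<le> M * nrm x"
      using growth[OF A] by blast
    have "cmod (\<tau> A n) * cmod w ^ n \<le> M" for n
      by (rule spectrum_growth[OF U w(1) M])
    from Abel_lemma[OF norm_ge_zero w(2) this] show ?thesis
      by (simp add: norm_mult norm_power)
  qed
  then show "summable (\<lambda>n. norm (\<tau> T n * z ^ n))" if "z \<in> interior (spectrum_on E nrm U)" for z
    using T commute that by blast
  have "(\<Sum>n. \<tau> T n * z ^ n) \<in> spectrum_on E nrm T" if z: "z \<in> interior (spectrum_on E nrm U)" for z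
  proof (rule ccontr)
    define c where "c = (\<Sum>n. \<tau> T n * z ^ n)"
    assume "(\<Sum>n. \<tau> T n * z ^ n) \<notin> spectrum_on E nrm T"
    then have "c \<notin> spectrum_on E nrm T"
      unfolding c_def .
    then obtain R where R: "bounded_operator E nrm R"
      and left: "\<And>x. x \<in> E \<Longrightarrow> R (\<lambda>n. T x n - c * x n) = x"
      and right: "\<And>x. x \<in> E \<Longrightarrow> (\<lambda>n. T (R x) n - c * R x n) = x"
      using resolvent[of c T] by blast
    have RU: "commute_on E R U"
      by (rule resolvent_commutes[OF T U R left right commute])
    show False
      using cauchy_inverse_series[OF summable[OF T commute z] summable[OF R RU z]
          product[OF T commute R RU right]] by (simp add: c_def)
  qed
  then show "closure ((\<lambda>z. \<Sum>n. \<tau> T n * z ^ n) ` interior (spectrum_on E nrm U)) \<subseteq> spectrum_on E nrm T"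
    by (intro closure_minimal closed_spectrum T) auto
qed

text \<open>
  Split off the first coordinate: \<open>b = b\<^sub>0 e\<^sub>0 + S S\<^sub>-\<^sub>1 b\<close>. This is where the right shift needs the
  left shift to preserve the space.
\<close>

lemma right_shift_commuting_decomposition:
  assumes T: "bounded_operator E nrm T" and commute: "commute_on E T right_shift"
    and left: "left_shift ` E \<subseteq> E" and right: "right_shift ` E \<subseteq> E" and b: "b \<in> E"
  shows "T b = (\<lambda>n. b 0 * T (unit_seq 0) n) + right_shift (T (left_shift b))"
proof -
  have mem: "left_shift b \<in> E" "right_shift (left_shift b) \<in> E"
    using left right b by auto
  have "b = (\<lambda>n. b 0 * unit_seq 0 n) + right_shift (left_shift b)"
    by (rule ext) (simp add: unit_seq_def right_shift_def left_shift_def)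
  then have "T b = T ((\<lambda>n. b 0 * unit_seq 0 n) + right_shift (left_shift b))"
    by (rule arg_cong)
  also have "\<dots> = T (\<lambda>n. b 0 * unit_seq 0 n) + T (right_shift (left_shift b))"
    by (intro bounded_operator_add[OF T] scale_mem unit_seq_mem mem)
  finally show ?thesis
    using commute mem(1) by (simp only: bounded_operator_scale[OF T unit_seq_mem] commute_on_def)
qed

text \<open>
  An operator commuting with the right shift is convolution with \<open>T e\<^sub>0\<close>, on the whole space and not
  only on finitely supported sequences: iterating the decomposition peels off the coordinates of
  \<open>b\<close> one by one, and the rest does not reach coordinate \<open>n\<close>.
\<close>

lemma right_shift_commuting_product:
  assumes T: "bounded_operator E nrm T" and commute: "commute_on E T right_shift"
    and left: "left_shift ` E \<subseteq> E" and right: "right_shift ` E \<subseteq> E" and b: "b \<in> E"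
  shows "T b n = (\<Sum>k\<le>n. T (unit_seq 0) k * b (n - k))"
  using b
proof (induction n arbitrary: b)
  case (0 b)
  note decompose = right_shift_commuting_decomposition[OF T commute left right 0]
  show ?case
    using fun_cong[OF decompose, of 0] by (simp add: right_shift_def)
next
  case (Suc n b)
  note decompose = right_shift_commuting_decomposition[OF T commute left right Suc.prems]
  have "left_shift b \<in> E"
    using left Suc.prems by blast
  then have "T (left_shift b) n = (\<Sum>k\<le>n. T (unit_seq 0) k * b (Suc n - k))"
    using Suc.IH by (simp add: left_shift_def Suc_diff_le)
  then show ?case
    using fun_cong[OF decompose, of "Suc n"] by (simp add: right_shift_def)
qed

lemma commute_funpow:
  assumes "bounded_operator E nrm U" "commute_on E T U" "x \<in> E"
  shows "T ((U ^^ n) x) = (U ^^ n) (T x)"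
proof (induction n)
  case (Suc n)
  then show ?case
    using assms bounded_operator_mem[OF bounded_operator_funpow[OF assms(1)] assms(3), of n]
    by (simp add: commute_on_def)
qed simp

text \<open>
  The Toeplitz structure of the matrix of \<open>T\<close>, from \<open>e\<^sub>j = S\<^sup>j e\<^sub>0\<close>.
\<close>

lemma right_shift_commuting_coefficients:
  assumes U: "bounded_operator E nrm right_shift" and commute: "commute_on E T right_shift"
  shows "T (unit_seq j) m = (if j \<le> m then T (unit_seq 0) (m - j) else 0)"
  using commute_funpow[OF U commute unit_seq_mem, of j 0]
  by (simp add: unit_seq_funpow_right_shift funpow_right_shift)

text \<open>
  The Toeplitz structure again, now upper triangular, read off from the coordinate \<open>0\<close> after \<open>m\<close>
  left shifts.
\<close>

lemma left_shift_commuting_coefficients: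
  assumes U: "bounded_operator E nrm left_shift" and commute: "commute_on E T left_shift"
    and T: "bounded_operator E nrm T"
  shows "T (unit_seq j) m = (if m \<le> j then T (unit_seq (j - m)) 0 else 0)"
proof -
  have shifted: "(left_shift ^^ m) (unit_seq j) = (if m \<le> j then unit_seq (j - m) else 0)"
    by (auto simp: funpow_left_shift unit_seq_def fun_eq_iff)
  have "T (unit_seq j) m = (left_shift ^^ m) (T (unit_seq j)) 0"
    by (simp add: funpow_left_shift)
  also have "\<dots> = T (if m \<le> j then unit_seq (j - m) else 0) 0"
    unfolding commute_funpow[OF U commute unit_seq_mem, symmetric] shifted ..
  finally show ?thesis
    using bounded_operator_zero[OF T] by auto
qed

text \<open>
  The coefficients of negative index vanish, so the symbol is the power series of \<open>T e\<^sub>0\<close>.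
\<close>

lemma right_shift_spectral_inclusion:
  assumes right: "right_shift ` E \<subseteq> E" and left: "left_shift ` E \<subseteq> E"
    and T: "bounded_operator E nrm T" and commute: "commute_on E T right_shift"
  shows "(\<forall>z \<in> interior (spectrum_on E nrm right_shift). symbol_summable T z) \<and>
    closure (symbol T ` interior (spectrum_on E nrm right_shift)) \<subseteq> spectrum_on E nrm T"
proof -
  note U = right_shift_bounded_operator[OF right]
  let ?\<tau> = "\<lambda>T :: (nat \<Rightarrow> complex) \<Rightarrow> nat \<Rightarrow> complex. T (unit_seq 0)"
  have growth: "\<exists>M. \<forall>n. \<forall>x\<in>E. cmod (?\<tau> A n) * nrm ((right_shift ^^ n) x) \<le> M * nrm x"
    if A: "bounded_operator E nrm A" "commute_on E A right_shift" for A
  proof -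
    have "coordinate_part (int n + int j) (A (unit_seq j)) =
        (\<lambda>m. ?\<tau> A n * (right_shift ^^ n) (unit_seq j) m)" for n j
    proof
      fix m
      show "coordinate_part (int n + int j) (A (unit_seq j)) m =
          ?\<tau> A n * (right_shift ^^ n) (unit_seq j) m"
      proof (cases "m = n + j")
        case True
        then show ?thesis
          using right_shift_commuting_coefficients[OF U A(2), of j m]
          by (simp add: coordinate_part_def funpow_right_shift unit_seq_same)
      next
        case False
        then have "(right_shift ^^ n) (unit_seq j) m = 0"
          by (auto simp: funpow_right_shift intro: unit_seq_other)
        then show ?thesis
          using False by (simp add: coordinate_part_def)
      qed
    qed
    then show ?thesis
      using homogeneous_component_bound[OF A(1)] bounded_operator_funpow[OF U] by metis
  qed
  have product: "(\<Sum>k\<le>n. ?\<tau> A k * ?\<tau> R (n - k)) - c * ?\<tau> R n = (if n = 0 then 1 else 0)"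
    if A: "bounded_operator E nrm A" "commute_on E A right_shift"
      and R: "bounded_operator E nrm R" "commute_on E R right_shift"
      and inverse: "\<And>x. x \<in> E \<Longrightarrow> (\<lambda>n. A (R x) n - c * R x n) = x" for A R c n
  proof -
    have "A (R (unit_seq 0)) n = (\<Sum>k\<le>n. ?\<tau> A k * ?\<tau> R (n - k))"
      by (rule right_shift_commuting_product[OF A left right bounded_operator_mem[OF R(1) unit_seq_mem]])
    moreover have "A (R (unit_seq 0)) n - c * R (unit_seq 0) n = unit_seq 0 n"
      by (rule fun_cong[OF inverse[OF unit_seq_mem]])
    ultimately show ?thesis
      by (cases "n = 0") (simp_all add: unit_seq_same unit_seq_other)
  qed
  have coeff: "symbol_coeff T n * z powi n = (if 0 \<le> n then ?\<tau> T (nat n) * z ^ nat n else 0)" for n z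
    using right_shift_commuting_coefficients[OF U commute, of "nat (- n)" 0]
    by (simp add: symbol_coeff_def power_int_def)
  have summable: "summable (\<lambda>n. norm (?\<tau> T n * z ^ n))" if "z \<in> interior (spectrum_on E nrm right_shift)" for z
    by (rule spectral_inclusion_of_symbol(1)[where \<tau> = ?\<tau>, OF U _ _ T commute that]) (fact growth product)+
  have inclusion: "closure ((\<lambda>z. \<Sum>n. ?\<tau> T n * z ^ n) ` interior (spectrum_on E nrm right_shift))
      \<subseteq> spectrum_on E nrm T"
    by (rule spectral_inclusion_of_symbol(2)[where \<tau> = ?\<tau>, OF U _ _ T commute]) (fact growth product)+
  have has_sum: "((\<lambda>n. symbol_coeff T n * z powi n) has_sum (\<Sum>n. ?\<tau> T n * z ^ n)) UNIV"
    if "z \<in> interior (spectrum_on E nrm right_shift)" for z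
  proof -
    have "((\<lambda>n. ?\<tau> T n * z ^ n) has_sum (\<Sum>n. ?\<tau> T n * z ^ n)) UNIV"
      by (intro norm_summable_imp_has_sum[OF summable[OF that]] summable_sums
          summable_norm_cancel[OF summable[OF that]])
    then have "((\<lambda>n. symbol_coeff T n * z powi n) has_sum (\<Sum>n. ?\<tau> T n * z ^ n)) (range int)"
      by (subst has_sum_reindex) (simp_all add: o_def coeff)
    then show ?thesis
    proof (rule has_sum_cong_neutral[THEN iffD1, rotated -1])
      show "symbol_coeff T n * z powi n = 0" if "n \<in> UNIV - range int" for n
      proof -
        have "\<not> 0 \<le> n"
          using that image_eqI[of n int "nat n" UNIV] by auto
        then show ?thesis
          by (simp add: coeff)
      qed
    qed auto
  qed
  have "symbol T z = (\<Sum>n. ?\<tau> T n * z ^ n)" if "z \<in> interior (spectrum_on E nrm right_shift)" for z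
    unfolding symbol_def by (rule infsumI[OF has_sum[OF that]])
  then have "symbol T ` interior (spectrum_on E nrm right_shift) =
      (\<lambda>z. \<Sum>n. ?\<tau> T n * z ^ n) ` interior (spectrum_on E nrm right_shift)"
    by (intro image_cong refl)
  then show ?thesis
    using inclusion has_sum unfolding symbol_summable_def summable_on_def by auto
qed

text \<open>
  The coefficients of positive index vanish, so the symbol at \<open>inverse w\<close> is a power series in \<open>w\<close>.
  This includes \<open>w = 0\<close>, where only the coefficient of index \<open>0\<close> contributes.
\<close>

lemma left_shift_spectral_inclusion:
  assumes left: "left_shift ` E \<subseteq> E"
    and T: "bounded_operator E nrm T" and commute: "commute_on E T left_shift"
  shows "(\<forall>w \<in> interior (spectrum_on E nrm left_shift). symbol_summable T (inverse w)) \<and>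
    closure ((\<lambda>w. symbol T (inverse w)) ` interior (spectrum_on E nrm left_shift))
      \<subseteq> spectrum_on E nrm T"
proof -
  note U = left_shift_bounded_operator[OF left]
  let ?\<tau> = "\<lambda>(T :: (nat \<Rightarrow> complex) \<Rightarrow> nat \<Rightarrow> complex) n. T (unit_seq n) 0"
  have growth: "\<exists>M. \<forall>n. \<forall>x\<in>E. cmod (?\<tau> A n) * nrm ((left_shift ^^ n) x) \<le> M * nrm x"
    if A: "bounded_operator E nrm A" "commute_on E A left_shift" for A
  proof -
    have "coordinate_part (- int n + int j) (A (unit_seq j)) =
        (\<lambda>m. ?\<tau> A n * (left_shift ^^ n) (unit_seq j) m)" for n j
    proof
      fix m
      show "coordinate_part (- int n + int j) (A (unit_seq j)) m =
          ?\<tau> A n * (left_shift ^^ n) (unit_seq j) m"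
      proof (cases "m + n = j")
        case True
        then have "A (unit_seq j) m = ?\<tau> A n"
          using left_shift_commuting_coefficients[OF U A(2,1), of j m] by auto
        then show ?thesis
          using True by (auto simp: coordinate_part_def funpow_left_shift unit_seq_same)
      next
        case False
        then have "(left_shift ^^ n) (unit_seq j) m = 0"
          by (auto simp: funpow_left_shift intro: unit_seq_other)
        then show ?thesis
          using False by (auto simp: coordinate_part_def)
      qed
    qed
    then show ?thesis
      using homogeneous_component_bound[OF A(1)] bounded_operator_funpow[OF U] by metis
  qed
  have product: "(\<Sum>k\<le>n. ?\<tau> A k * ?\<tau> R (n - k)) - c * ?\<tau> R n = (if n = 0 then 1 else 0)"
    if A: "bounded_operator E nrm A" "commute_on E A left_shift"
      and R: "bounded_operator E nrm R" "commute_on E R left_shift"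
      and inverse: "\<And>x. x \<in> E \<Longrightarrow> (\<lambda>n. A (R x) n - c * R x n) = x" for A R c n
  proof -
    have Rn: "R (unit_seq n) = (\<Sum>k\<le>n. (\<lambda>m. ?\<tau> R (n - k) * unit_seq k m))"
    proof
      fix m
      have "(\<Sum>k\<le>n. (\<lambda>m. ?\<tau> R (n - k) * unit_seq k m)) m
        = (\<Sum>k\<le>n. if k = m then ?\<tau> R (n - m) else 0)"
        unfolding sum_seq_apply by (rule sum.cong) (auto simp: unit_seq_same intro: unit_seq_other)
      then show "R (unit_seq n) m = (\<Sum>k\<le>n. (\<lambda>m. ?\<tau> R (n - k) * unit_seq k m)) m"
        using left_shift_commuting_coefficients[OF U R(2,1), of n m] by simp
    qed
    have "A (R (unit_seq n)) = (\<Sum>k\<le>n. A (\<lambda>m. ?\<tau> R (n - k) * unit_seq k m))"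
      unfolding Rn by (intro bounded_operator_sum[OF A(1)] scale_mem unit_seq_mem)
    also have "\<dots> = (\<Sum>k\<le>n. (\<lambda>m. ?\<tau> R (n - k) * A (unit_seq k) m))"
      by (intro sum.cong refl bounded_operator_scale[OF A(1)] unit_seq_mem)
    finally have "A (R (unit_seq n)) 0 = (\<Sum>k\<le>n. ?\<tau> A k * ?\<tau> R (n - k))"
      by (simp add: sum_seq_apply mult.commute)
    moreover have "A (R (unit_seq n)) 0 - c * R (unit_seq n) 0 = unit_seq n 0"
      by (rule fun_cong[OF inverse[OF unit_seq_mem]])
    ultimately show ?thesis
      by (cases "n = 0") (simp_all add: unit_seq_same unit_seq_other)
  qed
  have coeff: "symbol_coeff T n * inverse w powi n =
      (if n \<le> 0 then ?\<tau> T (nat (- n)) * w ^ nat (- n) else 0)" for n w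
    using left_shift_commuting_coefficients[OF U commute T, of 0 "nat n"]
    by (auto simp: symbol_coeff_def power_int_def)
  have summable: "summable (\<lambda>n. norm (?\<tau> T n * w ^ n))" if "w \<in> interior (spectrum_on E nrm left_shift)" for w
    by (rule spectral_inclusion_of_symbol(1)[where \<tau> = ?\<tau>, OF U _ _ T commute that]) (fact growth product)+
  have inclusion: "closure ((\<lambda>w. \<Sum>n. ?\<tau> T n * w ^ n) ` interior (spectrum_on E nrm left_shift))
      \<subseteq> spectrum_on E nrm T"
    by (rule spectral_inclusion_of_symbol(2)[where \<tau> = ?\<tau>, OF U _ _ T commute]) (fact growth product)+
  have has_sum: "((\<lambda>n. symbol_coeff T n * inverse w powi n) has_sum (\<Sum>n. ?\<tau> T n * w ^ n)) UNIV"
    if "w \<in> interior (spectrum_on E nrm left_shift)" for w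
  proof -
    have "((\<lambda>n. ?\<tau> T n * w ^ n) has_sum (\<Sum>n. ?\<tau> T n * w ^ n)) UNIV"
      by (intro norm_summable_imp_has_sum[OF summable[OF that]] summable_sums
          summable_norm_cancel[OF summable[OF that]])
    then have "((\<lambda>n. symbol_coeff T n * inverse w powi n) has_sum (\<Sum>n. ?\<tau> T n * w ^ n))
        (range (\<lambda>n. - int n))"
      by (subst has_sum_reindex) (simp_all add: o_def coeff inj_def)
    then show ?thesis
    proof (rule has_sum_cong_neutral[THEN iffD1, rotated -1])
      show "symbol_coeff T n * inverse w powi n = 0" if "n \<in> UNIV - range (\<lambda>n. - int n)" for n
      proof -
        have "\<not> n \<le> 0"
          using that image_eqI[of n "\<lambda>n. - int n" "nat (- n)" UNIV] by auto
        then show ?thesis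
          by (simp add: coeff)
      qed
    qed auto
  qed
  have "symbol T (inverse w) = (\<Sum>n. ?\<tau> T n * w ^ n)" if "w \<in> interior (spectrum_on E nrm left_shift)" for w
    unfolding symbol_def by (rule infsumI[OF has_sum[OF that]])
  then have "(\<lambda>w. symbol T (inverse w)) ` interior (spectrum_on E nrm left_shift) =
      (\<lambda>w. \<Sum>n. ?\<tau> T n * w ^ n) ` interior (spectrum_on E nrm left_shift)"
    by (intro image_cong refl)
  then show ?thesis
    using inclusion has_sum unfolding symbol_summable_def summable_on_def by auto
qed

end

theorem theorem5:
  fixes E :: "(nat \<Rightarrow> complex) set" and nrm :: "(nat \<Rightarrow> complex) \<Rightarrow> real"
  assumes "banach_sequence_space E nrm"
    and "right_shift ` E \<subseteq> E"
    and "left_shift ` E \<subseteq> E"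
  shows "(\<forall>T. bounded_operator E nrm T \<and> commute_on E T right_shift \<longrightarrow>
            (\<forall>z \<in> interior (spectrum_on E nrm right_shift). symbol_summable T z) \<and>
            closure (symbol T ` interior (spectrum_on E nrm right_shift)) \<subseteq> spectrum_on E nrm T)
       \<and> (\<forall>T. bounded_operator E nrm T \<and> commute_on E T left_shift \<longrightarrow>
            (\<forall>w \<in> interior (spectrum_on E nrm left_shift). symbol_summable T (inverse w)) \<and>
            closure ((\<lambda>w. symbol T (inverse w)) ` interior (spectrum_on E nrm left_shift))
              \<subseteq> spectrum_on E nrm T)"
proof -
  interpret banach_sequence_space E nrm
    by (rule assms(1))
  show ?thesis
    using right_shift_spectral_inclusion[OF assms(2,3)] left_shift_spectral_inclusion[OF assms(3)]
    by blast
qed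

end
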